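(* Let $\mathbb{K}$ be any field and let $n > 3$ be an integer. Let $G_n=\mathrm{SL}(n,\mathbb{K})$, let $A_n$ be its adjoint module (the space of traceless $n\times n$ matrices over $\mathbb{K}$, with $G_n$ acting by conjugation) and let $A_n^*$ be the dual $G_n$-module of $A_n$. Then $H^1(G_n,A_n^* )\cong \mathrm{Der}(\mathbb{K})$ (as $\mathbb{K}$-vector spaces).
   Context: $\mathcal{M}_n$ is the space of $n\times n$ matrices over $\mathbb{K}$; $G_n=\mathrm{SL}(n,\mathbb{K})$ acts on it on the right by $x\cdot g=g^{-1}xg$. $A_n=\{x\in\mathcal{M}_n : \mathrm{Tr}(x)=0\}$ is a submodule, the adjoint module. On the dual $A_n^*$ the group acts by $(\alpha\cdot g)(a)=\alpha(gag^{-1})$ for $a\in A_n$. Equivalently, $A_n^*$ is identified as a $G_n$-module with $\mathcal{M}_n/\mathcal{I}_n$, where $\mathcal{I}_n$ is the space of scalar matrices, with action $[x]\cdot g=[g^{-1}xg]$; the class $[x]=x+\mathcal{I}_n$ corresponds to the functional $a\mapsto \mathrm{Tr}(xa)$. For a group $X$ and a right $X$-module $V$ over $\mathbb{K}$: a $1$-cocycle is a map $f:X\to V$ with $f(g_1g_2)=f(g_1)\cdot g_2+f(g_2)$ for all $g_1,g_2$; a $1$-coboundary is a map $g\mapsto v-v\cdot g$ for some $v\in V$; $H^1(X,V)=Z^1(X,V)/B^1(X,V)$ is the quotient of the space of cocycles by the space of coboundaries, a $\mathbb{K}$-vector space. Here $G_n$ is regarded as an abstract group. $\mathrm{Der}(\mathbb{K})$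 is the $\mathbb{K}$-vector space of derivations of $\mathbb{K}$, i.e. maps $d:\mathbb{K}\to\mathbb{K}$ with $d(x+y)=d(x)+d(y)$ and $d(xy)=d(x)y+xd(y)$ for all $x,y\in\mathbb{K}$. *)

theory Defs
  imports "HOL-Analysis.Determinants" "HOL-Algebra.Module" "HOL-Algebra.AbelCoset"
begin

text \<open>
  Vector spaces over a field \<open>K\<close> are records of type \<open>module\<close> satisfying the HOL-Algebra
  locale \<open>module K V\<close>. The fields \<open>mult\<close> and \<open>one\<close> that this record type inherits from rings are
  meaningless for a vector space and are left unspecified where they are not needed.
\<close>

section \<open>Linear algebra\<close>

text \<open>The field of scalars given by a type. As it is of type \<open>module\<close>, it serves both as a ring
  and as a one-dimensional vector space over itself.\<close>

definition scalars :: "('a::field, 'a) module" where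
  "scalars = \<lparr>carrier = UNIV, mult = (*), one = 1, zero = 0, add = (+), smult = (*)\<rparr>"

definition fun_module :: "'x set \<Rightarrow> ('a, 'v) module \<Rightarrow> ('a, 'x \<Rightarrow> 'v) module" where
  "fun_module X V =
    \<lparr>carrier = X \<rightarrow>\<^sub>E carrier V,
     mult = undefined, one = undefined,
     zero = (\<lambda>x\<in>X. \<zero>\<^bsub>V\<^esub>),
     add = (\<lambda>f h. \<lambda>x\<in>X. f x \<oplus>\<^bsub>V\<^esub> h x),
     smult = (\<lambda>c f. \<lambda>x\<in>X. c \<odot>\<^bsub>V\<^esub> f x)\<rparr>"

text \<open>The set \<open>{c v + w | v \<in> A, w \<in> N}\<close> is used for \<open>c A\<close> because the plain image of the coset
  \<open>A\<close> would fail to be a coset of \<open>N\<close> for \<open>c = 0\<close>; see \<open>quotient_smult_coset\<close> below.\<close>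

definition quotient_module :: "('a, 'v) module \<Rightarrow> 'v set \<Rightarrow> ('a, 'v set) module" where
  "quotient_module M N =
    \<lparr>carrier = a_rcosets\<^bsub>M\<^esub> N,
     mult = undefined, one = undefined,
     zero = N,
     add = (\<lambda>A B. A <+>\<^bsub>M\<^esub> B),
     smult = (\<lambda>c A. \<Union>v\<in>A. N +>\<^bsub>M\<^esub> (c \<odot>\<^bsub>M\<^esub> v))\<rparr>"

definition linear_iso ::
    "('a, 'k) ring_scheme \<Rightarrow> ('a, 'v) module \<Rightarrow> ('a, 'w) module \<Rightarrow> ('v \<Rightarrow> 'w) set" where
  "linear_iso K V W =
    {h \<in> iso (add_monoid V) (add_monoid W).
       \<forall>c\<in>carrier K. \<forall>v\<in>carrier V. h (c \<odot>\<^bsub>V\<^esub> v) = c \<odot>\<^bsub>W\<^esub> h v}"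

definition linearly_isomorphic ::
    "('a, 'k) ring_scheme \<Rightarrow> ('a, 'v) module \<Rightarrow> ('a, 'w) module \<Rightarrow> bool" where
  "linearly_isomorphic K V W \<longleftrightarrow> linear_iso K V W \<noteq> {}"

lemma field_scalars: "field (scalars :: ('a::field, 'a) module)"
proof (rule cring.cring_fieldI2)
  show "cring (scalars :: ('a, 'a) module)"
  proof (rule cringI)
    show "abelian_group (scalars :: ('a, 'a) module)"
      by (rule abelian_groupI) (auto simp: scalars_def algebra_simps intro: exI[of _ "- _"])
    show "comm_monoid (scalars :: ('a, 'a) module)"
      by (rule comm_monoidI) (auto simp: scalars_def)
  qed (auto simp: scalars_def algebra_simps)
  show "\<exists>b\<in>carrier scalars. a \<otimes>\<^bsub>scalars\<^esub> b = \<one>\<^bsub>scalars\<^esub>"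
    if "a \<noteq> \<zero>\<^bsub>scalars\<^esub>" for a :: 'a
    using that by (auto simp: scalars_def intro: right_inverse)
qed (auto simp: scalars_def)

lemma module_scalars: "module scalars (scalars :: ('a::field, 'a) module)"
proof (rule moduleI)
  show "cring (scalars :: ('a, 'a) module)"
    by (rule field.axioms(1)[OF field_scalars, THEN domain.axioms(1)])
  show "abelian_group (scalars :: ('a, 'a) module)"
    using \<open>cring (scalars :: ('a, 'a) module)\<close> by (simp add: cring_def ring_def)
qed (auto simp: scalars_def algebra_simps)

lemma module_fun_module:
  assumes "module K V"
  shows "module K (fun_module X V)"
proof -
  interpret V: module K V by (rule assms)
  show ?thesis
  proof (rule moduleI)
    show "cring K" by (rule V.is_cring)
    show "abelian_group (fun_module X V)"
    proof (rule abelian_groupI)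
      show "\<exists>g\<in>carrier (fun_module X V). g \<oplus>\<^bsub>fun_module X V\<^esub> f = \<zero>\<^bsub>fun_module X V\<^esub>"
        if "f \<in> carrier (fun_module X V)" for f
        using that
        by (intro bexI[of _ "\<lambda>x\<in>X. \<ominus>\<^bsub>V\<^esub> f x"])
          (auto simp: fun_module_def PiE_iff V.l_neg intro!: restrict_ext)
    qed (auto simp: fun_module_def PiE_iff extensional_def V.a_ac intro!: ext)
  qed (auto simp: fun_module_def PiE_iff extensional_def restrict_def fun_eq_iff
      V.smult_l_distr V.smult_r_distr V.smult_assoc1)
qed

lemma quotient_smult_coset:
  assumes M: "module K M" and N: "submodule N K M" and c: "c \<in> carrier K" and v: "v \<in> carrier M"
  shows "c \<odot>\<^bsub>quotient_module M N\<^esub> (N +>\<^bsub>M\<^esub> v) = N +>\<^bsub>M\<^esub> (c \<odot>\<^bsub>M\<^esub> v)"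
proof -
  interpret M: module K M by (rule M)
  interpret N: submodule N K M by (rule N)
  interpret N: abelian_subgroup N M
    by (intro abelian_subgroupI3 additive_subgroupI N.subgroup_axioms M.abelian_group_axioms)
  have "N +>\<^bsub>M\<^esub> (c \<odot>\<^bsub>M\<^esub> w) = N +>\<^bsub>M\<^esub> (c \<odot>\<^bsub>M\<^esub> v)" if w: "w \<in> N +>\<^bsub>M\<^esub> v" for w
  proof -
    obtain n where n: "n \<in> N" "w = n \<oplus>\<^bsub>M\<^esub> v"
      using w by (auto simp: a_r_coset_def')
    then have nM: "n \<in> carrier M" using N.a_subset by auto
    have "c \<odot>\<^bsub>M\<^esub> w = c \<odot>\<^bsub>M\<^esub> n \<oplus>\<^bsub>M\<^esub> c \<odot>\<^bsub>M\<^esub> v"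
      using n nM v c by (simp add: M.smult_r_distr)
    moreover have "c \<odot>\<^bsub>M\<^esub> n \<in> N" using n c by (rule_tac N.smult_closed)
    ultimately have "c \<odot>\<^bsub>M\<^esub> w \<in> N +>\<^bsub>M\<^esub> (c \<odot>\<^bsub>M\<^esub> v)"
      by (auto simp: a_r_coset_def')
    then show ?thesis
      using M.a_repr_independence[OF _ _ N.a_subgroup] c v by simp
  qed
  moreover have "v \<in> N +>\<^bsub>M\<^esub> v" using N.a_rcos_self v by simp
  ultimately have "(\<Union>w\<in>N +>\<^bsub>M\<^esub> v. N +>\<^bsub>M\<^esub> (c \<odot>\<^bsub>M\<^esub> w)) = N +>\<^bsub>M\<^esub> (c \<odot>\<^bsub>M\<^esub> v)"
    by blast
  then show ?thesis by (simp add: quotient_module_def)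
qed

lemma module_quotient_module:
  assumes M: "module K M" and N: "submodule N K M"
  shows "module K (quotient_module M N)"
proof -
  interpret M: module K M by (rule M)
  interpret N: submodule N K M by (rule N)
  interpret N: abelian_subgroup N M
    by (intro abelian_subgroupI3 additive_subgroupI N.subgroup_axioms M.abelian_group_axioms)
  let ?Q = "quotient_module M N"
  have rep: "\<exists>v\<in>carrier M. A = N +>\<^bsub>M\<^esub> v" if "A \<in> carrier ?Q" for A
    using that by (auto simp: quotient_module_def A_RCOSETS_def')
  have coset: "N +>\<^bsub>M\<^esub> v \<in> carrier ?Q" if "v \<in> carrier M" for v
    using that by (auto simp: quotient_module_def A_RCOSETS_def')
  have add: "(N +>\<^bsub>M\<^esub> v) \<oplus>\<^bsub>?Q\<^esub> (N +>\<^bsub>M\<^esub> w) = N +>\<^bsub>M\<^esub> (v \<oplus>\<^bsub>M\<^esub> w)"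
    if "v \<in> carrier M" "w \<in> carrier M" for v w
    using N.a_rcos_sum[OF that] by (simp add: quotient_module_def)
  note smult = quotient_smult_coset[OF M N]
  show ?thesis
  proof (rule moduleI)
    show "cring K" by (rule M.is_cring)
    have zero: "\<zero>\<^bsub>?Q\<^esub> = N +>\<^bsub>M\<^esub> \<zero>\<^bsub>M\<^esub>"
      using N.a_subset by (simp add: quotient_module_def)
    show "abelian_group ?Q"
    proof (rule abelian_groupI)
      fix A assume "A \<in> carrier ?Q"
      then obtain v where v: "v \<in> carrier M" "A = N +>\<^bsub>M\<^esub> v" using rep by blast
      then show "\<exists>B\<in>carrier ?Q. B \<oplus>\<^bsub>?Q\<^esub> A = \<zero>\<^bsub>?Q\<^esub>"
        by (intro bexI[of _ "N +>\<^bsub>M\<^esub> (\<ominus>\<^bsub>M\<^esub> v)"]) (auto simp: add zero coset M.l_neg)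
    qed (auto simp: add coset zero M.a_ac dest!: rep)
  next
    fix c A assume "c \<in> carrier K" "A \<in> carrier ?Q"
    then show "c \<odot>\<^bsub>?Q\<^esub> A \<in> carrier ?Q"
      using rep[of A] by (auto simp: smult coset)
  next
    fix c d A assume "c \<in> carrier K" "d \<in> carrier K" "A \<in> carrier ?Q"
    then show "(c \<oplus>\<^bsub>K\<^esub> d) \<odot>\<^bsub>?Q\<^esub> A = c \<odot>\<^bsub>?Q\<^esub> A \<oplus>\<^bsub>?Q\<^esub> d \<odot>\<^bsub>?Q\<^esub> A"
      using rep[of A] by (auto simp: smult add M.smult_l_distr)
  next
    fix c A B assume "c \<in> carrier K" "A \<in> carrier ?Q" "B \<in> carrier ?Q"
    then show "c \<odot>\<^bsub>?Q\<^esub> (A \<oplus>\<^bsub>?Q\<^esub> B) = c \<odot>\<^bsub>?Q\<^esub> A \<oplus>\<^bsub>?Q\<^esub> c \<odot>\<^bsub>?Q\<^esub> B"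
      using rep[of A] rep[of B] by (auto simp: smult add M.smult_r_distr)
  next
    fix c d A assume "c \<in> carrier K" "d \<in> carrier K" "A \<in> carrier ?Q"
    then show "(c \<otimes>\<^bsub>K\<^esub> d) \<odot>\<^bsub>?Q\<^esub> A = c \<odot>\<^bsub>?Q\<^esub> (d \<odot>\<^bsub>?Q\<^esub> A)"
      using rep[of A] by (auto simp: smult M.smult_assoc1)
  next
    fix A assume "A \<in> carrier ?Q"
    then show "\<one>\<^bsub>K\<^esub> \<odot>\<^bsub>?Q\<^esub> A = A"
      using rep[of A] by (auto simp: smult)
  qed
qed

definition dual_module :: "('a::field, 'v) module \<Rightarrow> ('a, 'v \<Rightarrow> 'a) module" where
  "dual_module V = (fun_module (carrier V) scalars)
    \<lparr>carrier := {\<alpha> \<in> carrier V \<rightarrow>\<^sub>E UNIV.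
       (\<forall>v\<in>carrier V. \<forall>w\<in>carrier V. \<alpha> (v \<oplus>\<^bsub>V\<^esub> w) = \<alpha> v + \<alpha> w) \<and>
       (\<forall>c. \<forall>v\<in>carrier V. \<alpha> (c \<odot>\<^bsub>V\<^esub> v) = c * \<alpha> v)}\<rparr>"

lemma module_dual_module:
  assumes "module scalars (V :: ('a::field, 'v) module)"
  shows "module scalars (dual_module V)"
proof -
  interpret V: module scalars V by (rule assms)
  have M: "module scalars (fun_module (carrier V) (scalars :: ('a, 'a) module))"
    by (rule module_fun_module[OF module_scalars])
  interpret M: module scalars "fun_module (carrier V) (scalars :: ('a, 'a) module)"
    by (rule M)
  have smult: "c \<odot>\<^bsub>V\<^esub> v \<in> carrier V" if "v \<in> carrier V" for c v
    using that by (intro V.smult_closed) (auto simp: scalars_def)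
  let ?F = "fun_module (carrier V) (scalars :: ('a, 'a) module)"
  have inv: "\<ominus>\<^bsub>?F\<^esub> \<alpha> = (\<lambda>v\<in>carrier V. - \<alpha> v)" if "\<alpha> \<in> carrier ?F" for \<alpha>
  proof (rule M.minus_equality)
    show "(\<lambda>v\<in>carrier V. - \<alpha> v) \<oplus>\<^bsub>?F\<^esub> \<alpha> = \<zero>\<^bsub>?F\<^esub>"
      by (auto simp: fun_module_def scalars_def)
  qed (use that in \<open>auto simp: fun_module_def scalars_def\<close>)
  have "submodule (carrier (dual_module V)) scalars ?F"
  proof (rule M.submoduleI)
    show sub: "carrier (dual_module V) \<subseteq> carrier ?F"
      by (auto simp: dual_module_def fun_module_def scalars_def)
    show "\<ominus>\<^bsub>?F\<^esub> \<alpha> \<in> carrier (dual_module V)" if "\<alpha> \<in> carrier (dual_module V)" for \<alpha>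
      using that sub by (subst inv) (auto simp: dual_module_def smult)
  qed (auto simp: dual_module_def fun_module_def scalars_def smult algebra_simps)
  from submodule.submodule_is_module[OF this M] show ?thesis
    by (simp add: dual_module_def)
qed

section \<open>Right modules of a group and their first cohomology\<close>

locale group_module = G: group G + V: module K V
  for G :: "'g monoid" (structure) and K :: "('a, 'k) ring_scheme"
    and V :: "('a, 'v) module" and act :: "'v \<Rightarrow> 'g \<Rightarrow> 'v" +
  assumes act_closed: "\<lbrakk>v \<in> carrier V; g \<in> carrier G\<rbrakk> \<Longrightarrow> act v g \<in> carrier V"
    and act_add: "\<lbrakk>v \<in> carrier V; w \<in> carrier V; g \<in> carrier G\<rbrakk>
      \<Longrightarrow> act (v \<oplus>\<^bsub>V\<^esub> w) g = act v g \<oplus>\<^bsub>V\<^esub> act w g"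
    and act_smult: "\<lbrakk>c \<in> carrier K; v \<in> carrier V; g \<in> carrier G\<rbrakk>
      \<Longrightarrow> act (c \<odot>\<^bsub>V\<^esub> v) g = c \<odot>\<^bsub>V\<^esub> act v g"
    and act_one: "v \<in> carrier V \<Longrightarrow> act v \<one> = v"
    and act_mult: "\<lbrakk>v \<in> carrier V; g \<in> carrier G; h \<in> carrier G\<rbrakk>
      \<Longrightarrow> act v (g \<otimes> h) = act (act v g) h"

definition dual_action ::
    "'g monoid \<Rightarrow> ('a, 'v) module \<Rightarrow> ('v \<Rightarrow> 'g \<Rightarrow> 'v) \<Rightarrow> ('v \<Rightarrow> 'a) \<Rightarrow> 'g \<Rightarrow> ('v \<Rightarrow> 'a)" where
  "dual_action G V act \<alpha> g = (\<lambda>v\<in>carrier V. \<alpha> (act v (inv\<^bsub>G\<^esub> g)))"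

definition Z1 :: "'g monoid \<Rightarrow> ('a, 'v) module \<Rightarrow> ('v \<Rightarrow> 'g \<Rightarrow> 'v) \<Rightarrow> ('a, 'g \<Rightarrow> 'v) module" where
  "Z1 G V act = (fun_module (carrier G) V)
    \<lparr>carrier := {f \<in> carrier G \<rightarrow>\<^sub>E carrier V.
       \<forall>g\<in>carrier G. \<forall>h\<in>carrier G. f (g \<otimes>\<^bsub>G\<^esub> h) = act (f g) h \<oplus>\<^bsub>V\<^esub> f h}\<rparr>"

definition B1 :: "'g monoid \<Rightarrow> ('a, 'v) module \<Rightarrow> ('v \<Rightarrow> 'g \<Rightarrow> 'v) \<Rightarrow> ('g \<Rightarrow> 'v) set" where
  "B1 G V act = (\<lambda>v. \<lambda>g\<in>carrier G. v \<ominus>\<^bsub>V\<^esub> act v g) ` carrier V"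

definition H1 ::
    "'g monoid \<Rightarrow> ('a, 'v) module \<Rightarrow> ('v \<Rightarrow> 'g \<Rightarrow> 'v) \<Rightarrow> ('a, ('g \<Rightarrow> 'v) set) module" where
  "H1 G V act = quotient_module (Z1 G V act) (B1 G V act)"

lemma group_module_dual:
  fixes V :: "('a::field, 'v) module"
  assumes "group_module G scalars V act"
  shows "group_module G scalars (dual_module V) (dual_action G V act)"
proof -
  interpret group_module G scalars V act by (rule assms)
  have smult: "c \<odot>\<^bsub>V\<^esub> v \<in> carrier V" if "v \<in> carrier V" for c v
    using that by (intro V.smult_closed) (auto simp: scalars_def)
  have act_smult': "act (c \<odot>\<^bsub>V\<^esub> v) g = c \<odot>\<^bsub>V\<^esub> act v g"
    if "v \<in> carrier V" "g \<in> carrier G" for c v g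
    using that by (intro act_smult) (auto simp: scalars_def)
  interpret D: module scalars "dual_module V"
    by (rule module_dual_module[OF V.module_axioms])
  show ?thesis
    by unfold_locales
      (auto simp: dual_action_def dual_module_def fun_module_def scalars_def act_closed act_add
        act_smult' act_one act_mult smult PiE_iff extensional_def restrict_def fun_eq_iff
        G.inv_mult_group)
qed

context group_module
begin

lemma B1_submodule: "submodule (B1 G V act) K (Z1 G V act)"
  and module_Z1: "module K (Z1 G V act)"
proof -
  let ?F = "fun_module (carrier G) V"
  have M: "module K ?F" by (rule module_fun_module[OF V.module_axioms])
  interpret M: module K ?F by (rule M)
  have act_minus: "act (\<ominus>\<^bsub>V\<^esub> v) g = \<ominus>\<^bsub>V\<^esub> act v g" if "v \<in> carrier V" "g \<in> carrier G" for v g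
  proof -
    have "act (\<ominus>\<^bsub>V\<^esub> v) g \<oplus>\<^bsub>V\<^esub> act v g = act \<zero>\<^bsub>V\<^esub> g"
      using that by (simp add: act_add[symmetric] V.l_neg)
    also have "\<dots> = \<zero>\<^bsub>V\<^esub>"
      by (metis V.zero_closed V.add.r_cancel_one act_add act_closed that(2) V.l_zero)
    finally show ?thesis using that by (simp add: V.minus_equality act_closed)
  qed
  have act_zero: "act \<zero>\<^bsub>V\<^esub> g = \<zero>\<^bsub>V\<^esub>" if "g \<in> carrier G" for g
    by (metis V.zero_closed V.add.r_cancel_one act_add act_closed that V.l_zero)
  have inv: "\<ominus>\<^bsub>?F\<^esub> f = (\<lambda>g\<in>carrier G. \<ominus>\<^bsub>V\<^esub> f g)" if "f \<in> carrier ?F" for f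
  proof (rule M.minus_equality)
    show "(\<lambda>g\<in>carrier G. \<ominus>\<^bsub>V\<^esub> f g) \<oplus>\<^bsub>?F\<^esub> f = \<zero>\<^bsub>?F\<^esub>"
      using that by (auto simp: fun_module_def PiE_iff V.l_neg intro!: restrict_ext)
  qed (use that in \<open>auto simp: fun_module_def\<close>)
  have Z: "submodule (carrier (Z1 G V act)) K ?F"
  proof (rule M.submoduleI)
    show sub: "carrier (Z1 G V act) \<subseteq> carrier ?F"
      by (auto simp: Z1_def fun_module_def)
    show "\<ominus>\<^bsub>?F\<^esub> f \<in> carrier (Z1 G V act)" if "f \<in> carrier (Z1 G V act)" for f
      using that sub
      by (subst inv) (auto simp: Z1_def PiE_iff act_closed act_minus V.minus_add)
  qed (auto simp: Z1_def fun_module_def PiE_iff act_closed act_add act_zero act_smult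
      V.smult_r_distr V.a_ac)
  from submodule.submodule_is_module[OF this M] show MZ: "module K (Z1 G V act)"
    by (simp add: Z1_def)
  interpret Z: module K "Z1 G V act" by (rule MZ)
  define b where "b = (\<lambda>v. \<lambda>g\<in>carrier G. v \<ominus>\<^bsub>V\<^esub> act v g)"
  have B1: "B1 G V act = b ` carrier V" by (simp add: B1_def b_def)
  have bZ: "b v \<in> carrier (Z1 G V act)" if v: "v \<in> carrier V" for v
  proof -
    have "v \<ominus>\<^bsub>V\<^esub> act (act v g) h = act (v \<ominus>\<^bsub>V\<^esub> act v g) h \<oplus>\<^bsub>V\<^esub> (v \<ominus>\<^bsub>V\<^esub> act v h)"
      if "g \<in> carrier G" "h \<in> carrier G" for g h
    proof -
      have "act (v \<ominus>\<^bsub>V\<^esub> act v g) h \<oplus>\<^bsub>V\<^esub> (v \<ominus>\<^bsub>V\<^esub> act v h)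
          = (act v h \<oplus>\<^bsub>V\<^esub> \<ominus>\<^bsub>V\<^esub> act (act v g) h) \<oplus>\<^bsub>V\<^esub> (v \<oplus>\<^bsub>V\<^esub> \<ominus>\<^bsub>V\<^esub> act v h)"
        using v that by (simp add: V.minus_eq act_add act_minus act_closed)
      also have "\<dots> = (v \<oplus>\<^bsub>V\<^esub> \<ominus>\<^bsub>V\<^esub> act (act v g) h) \<oplus>\<^bsub>V\<^esub> (act v h \<oplus>\<^bsub>V\<^esub> \<ominus>\<^bsub>V\<^esub> act v h)"
        using v that by (simp add: V.a_ac act_closed)
      also have "\<dots> = v \<ominus>\<^bsub>V\<^esub> act (act v g) h"
        using v that by (simp add: V.minus_eq V.r_neg act_closed)
      finally show ?thesis by simp
    qed
    then show ?thesis using v by (auto simp: b_def Z1_def act_closed act_mult)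
  qed
  have b_add: "b v \<oplus>\<^bsub>Z1 G V act\<^esub> b w = b (v \<oplus>\<^bsub>V\<^esub> w)" if "v \<in> carrier V" "w \<in> carrier V" for v w
    using that by (auto simp: b_def Z1_def fun_module_def V.minus_eq act_closed act_add
        V.minus_add V.a_ac intro!: restrict_ext)
  have b_smult: "c \<odot>\<^bsub>Z1 G V act\<^esub> b v = b (c \<odot>\<^bsub>V\<^esub> v)" if "c \<in> carrier K" "v \<in> carrier V" for c v
    using that by (auto simp: b_def Z1_def fun_module_def V.minus_eq act_closed act_smult
        V.smult_r_distr V.smult_r_minus intro!: restrict_ext)
  have b_zero: "b \<zero>\<^bsub>V\<^esub> = \<zero>\<^bsub>Z1 G V act\<^esub>"
    by (auto simp: b_def Z1_def fun_module_def V.minus_eq act_zero intro!: restrict_ext)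
  have b_minus: "\<ominus>\<^bsub>Z1 G V act\<^esub> b v = b (\<ominus>\<^bsub>V\<^esub> v)" if "v \<in> carrier V" for v
    using that by (intro Z.minus_equality) (auto simp: b_add V.l_neg b_zero bZ)
  show "submodule (B1 G V act) K (Z1 G V act)"
    unfolding B1
  proof (rule Z.submoduleI)
    show "\<zero>\<^bsub>Z1 G V act\<^esub> \<in> b ` carrier V"
      unfolding b_zero[symmetric] by (rule imageI) simp
  qed (use bZ in \<open>auto simp: b_add b_smult b_minus\<close>)
qed

lemma module_H1: "module K (H1 G V act)"
  unfolding H1_def by (rule module_quotient_module[OF module_Z1 B1_submodule])

end

section \<open>The special linear group, its adjoint module, and derivations\<close>

definition SL :: "('a::field^'n^'n) monoid" where
  "SL = \<lparr>carrier = {g. det g = 1}, mult = (**), one = mat 1\<rparr>"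

definition adjoint_module :: "('a::field, 'a^'n^'n) module" where
  "adjoint_module =
    \<lparr>carrier = {x. trace x = 0}, mult = undefined, one = undefined, zero = 0, add = (+),
     smult = (\<lambda>c x. \<chi> i j. c * x $ i $ j)\<rparr>"

definition adjoint_action :: "'a::field^'n^'n \<Rightarrow> 'a^'n^'n \<Rightarrow> 'a^'n^'n" where
  "adjoint_action x g = inv\<^bsub>SL\<^esub> g ** x ** g"

definition coadjoint_module :: "('a::field, 'a^'n^'n \<Rightarrow> 'a) module" where
  "coadjoint_module = dual_module adjoint_module"

definition coadjoint_action :: "('a::field^'n^'n \<Rightarrow> 'a) \<Rightarrow> 'a^'n^'n \<Rightarrow> ('a^'n^'n \<Rightarrow> 'a)" where
  "coadjoint_action = dual_action SL adjoint_module adjoint_action"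

definition Der :: "('a::field, 'a \<Rightarrow> 'a) module" where
  "Der = (fun_module UNIV scalars)
    \<lparr>carrier := {d. (\<forall>x y. d (x + y) = d x + d y) \<and> (\<forall>x y. d (x * y) = d x * y + x * d y)}\<rparr>"

lemma module_Der: "module scalars (Der :: ('a::field, 'a \<Rightarrow> 'a) module)"
proof -
  let ?F = "fun_module UNIV (scalars :: ('a, 'a) module)"
  have M: "module scalars ?F" by (rule module_fun_module[OF module_scalars])
  interpret M: module scalars ?F by (rule M)
  have inv: "\<ominus>\<^bsub>?F\<^esub> f = (\<lambda>x. - f x)" for f
    by (rule M.minus_equality) (auto simp: fun_module_def scalars_def)
  have "submodule (carrier (Der :: ('a, 'a \<Rightarrow> 'a) module)) scalars ?F"
    by (rule M.submoduleI) (auto simp: inv, auto simp: Der_def fun_module_def scalars_def algebra_simps)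
  from submodule.submodule_is_module[OF this M] show ?thesis
    by (simp add: Der_def)
qed

lemma SL_inverse:
  fixes g :: "'a::field^'n^'n"
  assumes "det g = 1"
  obtains h where "det h = 1" "h ** g = mat 1" "g ** h = mat 1"
proof -
  obtain h where h: "g ** h = mat 1" "h ** g = mat 1"
    using assms invertible_det_nz[of g] by (auto simp: invertible_def)
  have "det g * det h = 1" using h(1) by (metis det_mul det_I)
  with h assms that show ?thesis by simp
qed

lemma group_SL: "group (SL :: ('a::field^'n^'n) monoid)"
proof (rule groupI)
  show "\<exists>h\<in>carrier SL. h \<otimes>\<^bsub>SL\<^esub> g = \<one>\<^bsub>SL\<^esub>" if "g \<in> carrier SL" for g :: "'a^'n^'n"
    using that by (auto simp: SL_def elim: SL_inverse)
qed (auto simp: SL_def det_mul matrix_mul_assoc)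

lemma trace_conj:
  fixes x :: "'a::field^'n^'n"
  assumes "g ** h = mat 1"
  shows "trace (h ** x ** g) = trace x"
proof -
  have "trace (h ** x ** g) = trace (g ** (h ** x))" by (rule trace_mul_sym)
  also have "g ** (h ** x) = x" by (simp add: matrix_mul_assoc assms)
  finally show ?thesis .
qed

lemma group_module_adjoint:
  "group_module SL scalars (adjoint_module :: ('a::field, 'a^'n^'n) module) adjoint_action"
proof -
  interpret G: group "SL :: ('a^'n^'n) monoid" by (rule group_SL)
  have tr: "trace (\<chi> i j. c * x $ i $ j) = c * trace x" for c and x :: "'a^'n^'n"
    by (simp add: trace_def sum_distrib_left)
  interpret V: module scalars "adjoint_module :: ('a, 'a^'n^'n) module"
  proof (rule moduleI)
    show "cring (scalars :: ('a, 'a) module)"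
      by (rule field.axioms(1)[OF field_scalars, THEN domain.axioms(1)])
    show "abelian_group (adjoint_module :: ('a, 'a^'n^'n) module)"
    proof (rule abelian_groupI)
      show "\<exists>y\<in>carrier adjoint_module. y \<oplus>\<^bsub>adjoint_module\<^esub> x = \<zero>\<^bsub>adjoint_module\<^esub>"
        if "x \<in> carrier adjoint_module" for x :: "'a^'n^'n"
        using that by (intro bexI[of _ "- x"]) (auto simp: adjoint_module_def trace_def sum_negf)
    qed (auto simp: adjoint_module_def trace_add algebra_simps, simp add: trace_def)
  qed (auto simp: adjoint_module_def scalars_def tr vec_eq_iff algebra_simps)
  have inv: "inv\<^bsub>SL\<^esub> g ** g = mat 1" "g ** inv\<^bsub>SL\<^esub> g = mat 1" if "g \<in> carrier SL" for g :: "'a^'n^'n"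
    using G.l_inv[OF that] G.r_inv[OF that] by (simp_all add: SL_def)
  have smult: "A ** (\<chi> i j. c * x $ i $ j) = (\<chi> i j. c * (A ** x) $ i $ j)"
    "(\<chi> i j. c * x $ i $ j) ** A = (\<chi> i j. c * (x ** A) $ i $ j)" for A x :: "'a^'n^'n" and c
    by (auto simp: matrix_matrix_mult_def vec_eq_iff sum_distrib_left algebra_simps)
  show ?thesis
  proof unfold_locales
    fix v g :: "'a^'n^'n" assume "v \<in> carrier adjoint_module" "g \<in> carrier SL"
    then show "adjoint_action v g \<in> carrier adjoint_module"
      by (simp add: adjoint_module_def adjoint_action_def trace_conj inv)
  next
    fix v w g :: "'a^'n^'n"
    have add_rdistrib: "(A + B) ** C = A ** C + B ** C" for A B C :: "'a^'n^'n"
      by (simp add: matrix_matrix_mult_def vec_eq_iff distrib_right sum.distrib)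
    show "adjoint_action (v \<oplus>\<^bsub>adjoint_module\<^esub> w) g =
        adjoint_action v g \<oplus>\<^bsub>adjoint_module\<^esub> adjoint_action w g"
      by (simp add: adjoint_module_def adjoint_action_def matrix_add_ldistrib add_rdistrib)
  next
    fix c :: 'a and v g :: "'a^'n^'n"
    show "adjoint_action (c \<odot>\<^bsub>adjoint_module\<^esub> v) g = c \<odot>\<^bsub>adjoint_module\<^esub> adjoint_action v g"
      by (simp add: adjoint_module_def adjoint_action_def smult)
  next
    fix v :: "'a^'n^'n"
    have "inv\<^bsub>SL\<^esub> (mat 1 :: 'a^'n^'n) = mat 1" using G.inv_one by (simp add: SL_def)
    then show "adjoint_action v \<one>\<^bsub>SL\<^esub> = v" by (simp add: adjoint_action_def SL_def)
  next
    fix v g h :: "'a^'n^'n" assume "g \<in> carrier SL" "h \<in> carrier SL"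
    then have "inv\<^bsub>SL\<^esub> (g ** h) = inv\<^bsub>SL\<^esub> h ** inv\<^bsub>SL\<^esub> g"
      using G.inv_mult_group[of g h] by (simp add: SL_def)
    then show "adjoint_action v (g \<otimes>\<^bsub>SL\<^esub> h) = adjoint_action (adjoint_action v g) h"
      by (simp add: adjoint_action_def SL_def matrix_mul_assoc)
  qed
qed

lemma group_module_coadjoint:
  "group_module SL scalars (coadjoint_module :: ('a::field, 'a^'n^'n \<Rightarrow> 'a) module) coadjoint_action"
  unfolding coadjoint_module_def coadjoint_action_def
  by (rule group_module_dual[OF group_module_adjoint])

lemma coadjoint_action_apply:
  fixes g :: "'a::field^'n^'n"
  assumes "g \<in> carrier SL" and "trace a = 0"
  shows "coadjoint_action \<alpha> g a = \<alpha> (g ** a ** inv\<^bsub>SL\<^esub> g)"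
proof -
  interpret G: group "SL :: ('a^'n^'n) monoid" by (rule group_SL)
  show ?thesis
    using assms by (simp add: coadjoint_action_def dual_action_def adjoint_action_def
        adjoint_module_def)
qed

end

theory Submission
  imports Defs
begin

text \<open>
  The dual of the adjoint module is the space of all matrices modulo scalar matrices, via the trace
  form, so a cocycle is a map \<open>F\<close> into matrices that satisfies the cocycle rule modulo scalars.
  Write \<open>e\<^sub>i\<^sub>j(t)\<close> for the elementary matrices. Since \<open>e\<^sub>i\<^sub>j(s)\<close> and \<open>e\<^sub>k\<^sub>l(t)\<close> commute
  whenever \<open>i \<noteq> l\<close> and \<open>j \<noteq> k\<close>, comparing the entries of \<open>F(e\<^sub>i\<^sub>j(s) e\<^sub>k\<^sub>l(t))\<close> and
  \<open>F(e\<^sub>k\<^sub>l(t) e\<^sub>i\<^sub>j(s))\<close> shows that, after subtracting the coboundary of a matrix whose entries are read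
  off from the diagonals of the \<open>F(e\<^sub>i\<^sub>j(1))\<close>, each \<open>F(e\<^sub>i\<^sub>j(s))\<close> is \<open>x\<^sub>i\<^sub>j(s) E\<^sub>i\<^sub>j\<close> modulo scalars.
  The commutator relation \<open>[e\<^sub>i\<^sub>j(s), e\<^sub>j\<^sub>k(t)] = e\<^sub>i\<^sub>k(st)\<close> then gives
  \<open>x\<^sub>i\<^sub>k(st) = x\<^sub>i\<^sub>j(s) t + s x\<^sub>j\<^sub>k(t)\<close>, and subtracting a diagonal coboundary that makes every
  \<open>x\<^sub>i\<^sub>j(1)\<close> vanish turns all \<open>x\<^sub>i\<^sub>j\<close> into one derivation \<open>d\<close>. Elementary matrices generate \<open>SL\<close>,
  so \<open>F\<close> is cohomologous to \<open>g \<mapsto> g\<^sup>-\<^sup>1 d(g)\<close>.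
\<close>

section \<open>Elementary matrices\<close>

definition unit_mat :: "'n \<Rightarrow> 'n \<Rightarrow> 'a::field \<Rightarrow> 'a^'n^'n" where
  "unit_mat i j t = (\<chi> a b. if a = i \<and> b = j then t else 0)"

definition elem_mat :: "'n \<Rightarrow> 'n \<Rightarrow> 'a::field \<Rightarrow> 'a^'n^'n" where
  "elem_mat i j t = mat 1 + unit_mat i j t"

lemma unit_mat_nth: "unit_mat i j t $ a $ b = (if a = i \<and> b = j then t else 0)"
  by (simp add: unit_mat_def)

lemma mult_unit_mat_nth:
  "(X ** unit_mat i j t) $ a $ b = (if b = j then X $ a $ i * t else 0)"
proof -
  have "(X ** unit_mat i j t) $ a $ b = (\<Sum>k\<in>UNIV. if k = i then (if b = j then X $ a $ i * t else 0) else 0)"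
    by (simp only: matrix_matrix_mult_def vec_lambda_beta, rule sum.cong) (auto simp: unit_mat_nth)
  then show ?thesis by simp
qed

lemma unit_mat_mult_nth:
  "(unit_mat i j t ** X) $ a $ b = (if a = i then t * X $ j $ b else 0)"
proof -
  have "(unit_mat i j t ** X) $ a $ b = (\<Sum>k\<in>UNIV. if k = j then (if a = i then t * X $ j $ b else 0) else 0)"
    by (simp only: matrix_matrix_mult_def vec_lambda_beta, rule sum.cong) (auto simp: unit_mat_nth)
  then show ?thesis by simp
qed

lemma matrix_add_rdistrib: "(A + B) ** C = A ** C + B ** C" for A :: "'a::semiring_1^'n^'m"
  by (simp add: matrix_matrix_mult_def vec_eq_iff distrib_right sum.distrib)

lemma matrix_diff_ldistrib: "A ** (B - C) = A ** B - A ** C" for A :: "'a::ring_1^'n^'m"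
  by (simp add: matrix_matrix_mult_def vec_eq_iff right_diff_distrib sum_subtractf)

lemma matrix_diff_rdistrib: "(A - B) ** C = A ** C - B ** C" for A :: "'a::ring_1^'n^'m"
  by (simp add: matrix_matrix_mult_def vec_eq_iff left_diff_distrib sum_subtractf)

lemma elem_mat_mult_nth:
  "(elem_mat i j t ** X) $ a $ b = X $ a $ b + (if a = i then t * X $ j $ b else 0)"
  by (simp add: elem_mat_def matrix_add_rdistrib unit_mat_mult_nth)

lemma mult_elem_mat_nth:
  "(X ** elem_mat i j t) $ a $ b = X $ a $ b + (if b = j then X $ a $ i * t else 0)"
  by (simp add: elem_mat_def matrix_add_ldistrib mult_unit_mat_nth)

lemma elem_mat_nth:
  "elem_mat i j t $ a $ b = (if a = b then 1 else 0) + (if a = i \<and> b = j then t else 0)"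
  by (simp add: elem_mat_def unit_mat_nth mat_def)

lemma elem_mat_zero [simp]: "elem_mat i j 0 = mat 1"
  by (simp add: vec_eq_iff elem_mat_nth mat_def)

lemma elem_mat_add: "i \<noteq> j \<Longrightarrow> elem_mat i j s ** elem_mat i j t = elem_mat i j (s + t)"
  by (auto simp: vec_eq_iff elem_mat_mult_nth elem_mat_nth algebra_simps)

lemma elem_mat_inverse:
  "i \<noteq> j \<Longrightarrow> elem_mat i j t ** elem_mat i j (- t) = mat 1"
  "i \<noteq> j \<Longrightarrow> elem_mat i j (- t) ** elem_mat i j t = mat 1"
  by (simp_all add: elem_mat_add)

lemma elem_mat_commute:
  "\<lbrakk>i \<noteq> l; j \<noteq> k\<rbrakk> \<Longrightarrow> elem_mat i j s ** elem_mat k l t = elem_mat k l t ** elem_mat i j s"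
  by (auto simp: vec_eq_iff elem_mat_mult_nth elem_mat_nth algebra_simps)

text \<open>The commutator relation is solved for a product without inverses, so that the cocycle
  rule expands both sides directly.\<close>

lemma elem_mat_commutator:
  assumes "i \<noteq> j" "j \<noteq> k" "i \<noteq> k"
  shows "elem_mat i j s ** elem_mat j k t = elem_mat j k t ** elem_mat i j s ** elem_mat i k (s * t)"
  using assms by (auto simp: vec_eq_iff mult_elem_mat_nth elem_mat_nth algebra_simps)

lemma det_elem_mat:
  assumes "i \<noteq> j"
  shows "det (elem_mat i j t) = 1"
proof -
  have "(\<chi> k. if k = i then row i (mat 1) + t *s row j (mat 1) else row k (mat 1)) = elem_mat i j t"
    using assms by (auto simp: vec_eq_iff row_def mat_def elem_mat_nth)
  with det_row_operation[OF assms, of "mat 1" t] show ?thesis by simp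
qed

text \<open>Expansion of \<open>(1 - t E_ij) X (1 + t E_ij)\<close>; the quadratic term comes from
  \<open>E_ij X E_ij = X_ji E_ij\<close>.\<close>

lemma elem_mat_conj_nth:
  "(elem_mat i j (- t) ** X ** elem_mat i j t) $ a $ b =
     X $ a $ b + (if b = j then t * X $ a $ i else 0) - (if a = i then t * X $ j $ b else 0)
       - (if a = i \<and> b = j then t * t * X $ j $ i else 0)"
  by (auto simp: mult_elem_mat_nth elem_mat_mult_nth algebra_simps)

section \<open>Matrix cocycles modulo scalars\<close>

definition scalar_cong :: "'a::field^'n^'n \<Rightarrow> 'a^'n^'n \<Rightarrow> bool"  (infix "\<approx>" 50) where
  "X \<approx> Y \<longleftrightarrow> (\<exists>c. X = Y + mat c)"

lemma scalar_cong_refl [simp]: "X \<approx> X"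
  unfolding scalar_cong_def by (rule exI[of _ 0]) (simp add: vec_eq_iff mat_def)

lemma mat_plus: "mat (c + d) = mat c + (mat d :: 'a::field^'n^'n)"
  and mat_diff: "mat (c - d) = mat c - (mat d :: 'a::field^'n^'n)"
  and mat_uminus: "mat (- c) = - (mat c :: 'a::field^'n^'n)"
  by (auto simp: vec_eq_iff mat_def)

lemma scalar_cong_sym: "X \<approx> Y \<Longrightarrow> Y \<approx> X"
  unfolding scalar_cong_def by (elim exE) (rule_tac x = "- c" in exI, simp add: mat_uminus)

lemma scalar_cong_trans [trans]: "X \<approx> Y \<Longrightarrow> Y \<approx> Z \<Longrightarrow> X \<approx> Z"
  unfolding scalar_cong_def by (elim exE) (rule_tac x = "ca + c" in exI, simp add: mat_plus)

lemma scalar_cong_add: "X \<approx> Y \<Longrightarrow> X' \<approx> Y' \<Longrightarrow> X + X' \<approx> Y + Y'"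
  unfolding scalar_cong_def by (elim exE) (rule_tac x = "c + ca" in exI, simp add: mat_plus)

lemma scalar_cong_diff: "X \<approx> Y \<Longrightarrow> X' \<approx> Y' \<Longrightarrow> X - X' \<approx> Y - Y'"
  unfolding scalar_cong_def by (elim exE) (rule_tac x = "c - ca" in exI, simp add: mat_diff)

text \<open>Off-diagonal entries and differences of diagonal entries are exactly the data that
  survive division by scalar matrices.\<close>

lemma scalar_cong_iff:
  "X \<approx> Y \<longleftrightarrow> (\<forall>a b. a \<noteq> b \<longrightarrow> X $ a $ b = Y $ a $ b) \<and>
     (\<forall>a b. X $ a $ a - Y $ a $ a = X $ b $ b - Y $ b $ b)"
proof
  assume *: "(\<forall>a b. a \<noteq> b \<longrightarrow> X $ a $ b = Y $ a $ b) \<and>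
     (\<forall>a b. X $ a $ a - Y $ a $ a = X $ b $ b - Y $ b $ b)"
  show "X \<approx> Y"
    unfolding scalar_cong_def
  proof
    fix k
    have "X $ a $ b = (Y + mat (X $ k $ k - Y $ k $ k)) $ a $ b" for a b
    proof (cases "a = b")
      case True
      have "X $ a $ a - Y $ a $ a = X $ k $ k - Y $ k $ k" using * by blast
      then show ?thesis using True by (simp add: mat_def diff_eq_eq add.commute)
    qed (use * in \<open>simp add: mat_def\<close>)
    then show "X = Y + mat (X $ k $ k - Y $ k $ k)" unfolding vec_eq_iff by blast
  qed
qed (force simp: scalar_cong_def mat_def)

lemma mat_mult_nth: "(mat c ** X) $ a $ b = c * X $ a $ b"
  for X :: "'a::field^'m^'n"
proof -
  have "(mat c ** X) $ a $ b = (\<Sum>k\<in>UNIV. if k = a then c * X $ a $ b else 0)"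
    by (simp only: matrix_matrix_mult_def vec_lambda_beta, rule sum.cong) (auto simp: mat_def)
  then show ?thesis by simp
qed

lemma mult_mat_nth: "(X ** mat c) $ a $ b = X $ a $ b * c"
  for X :: "'a::field^'m^'n"
proof -
  have "(X ** mat c) $ a $ b = (\<Sum>k\<in>UNIV. if k = b then X $ a $ b * c else 0)"
    by (simp only: matrix_matrix_mult_def vec_lambda_beta, rule sum.cong) (auto simp: mat_def)
  then show ?thesis by simp
qed

text \<open>Scalar matrices are central, so conjugation leaves the difference of \<open>X\<close>
  and \<open>Y\<close> unchanged.\<close>

lemma scalar_cong_conj:
  assumes "X \<approx> Y" "h' ** h = mat 1"
  shows "h' ** X ** h \<approx> h' ** Y ** h"
proof -
  obtain c where c: "X = Y + mat c" using assms by (auto simp: scalar_cong_def)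
  have "h' ** mat c = mat c ** h'"
    by (simp add: vec_eq_iff mat_mult_nth mult_mat_nth)
  then have "h' ** mat c ** h = mat c ** (h' ** h)"
    by (simp add: matrix_mul_assoc)
  then have "h' ** mat c ** h = mat c"
    using assms by simp
  then show ?thesis
    unfolding c scalar_cong_def
    by (intro exI[of _ c]) (simp add: matrix_add_ldistrib matrix_add_rdistrib)
qed

text \<open>The inverse is a variable \<open>h'\<close> rather than \<open>matrix_inv h\<close>, so
  that explicit inverses such as \<open>elem_mat i j (- t)\<close> can be inserted directly.\<close>

definition matrix_cocycle :: "('a::field^'n^'n \<Rightarrow> 'a^'n^'n) \<Rightarrow> bool" where
  "matrix_cocycle F \<longleftrightarrow> (\<forall>g h h'. det g = 1 \<longrightarrow> det h = 1 \<longrightarrow> h ** h' = mat 1 \<longrightarrow>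
     F (g ** h) \<approx> h' ** F g ** h + F h)"

lemma matrix_cocycleD:
  "\<lbrakk>matrix_cocycle F; det g = 1; det h = 1; h ** h' = mat 1\<rbrakk> \<Longrightarrow> F (g ** h) \<approx> h' ** F g ** h + F h"
  by (auto simp: matrix_cocycle_def)

lemma matrix_cocycle_one:
  assumes "matrix_cocycle F"
  shows "F (mat 1) \<approx> 0"
  using scalar_cong_diff[OF matrix_cocycleD[OF assms, of "mat 1" "mat 1" "mat 1"] scalar_cong_refl, of "F (mat 1)"]
  by (auto intro: scalar_cong_sym)

lemma matrix_cocycle_diff:
  fixes F F' :: "'a::field^'n^'n \<Rightarrow> 'a^'n^'n"
  assumes "matrix_cocycle F" "matrix_cocycle F'"
  shows "matrix_cocycle (\<lambda>g. F g - F' g)"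
  unfolding matrix_cocycle_def
proof (intro allI impI)
  fix g h h' :: "'a^'n^'n" assume "det g = 1" "det h = 1" "h ** h' = mat 1"
  from scalar_cong_diff[OF matrix_cocycleD[OF assms(1) this] matrix_cocycleD[OF assms(2) this]]
  show "F (g ** h) - F' (g ** h) \<approx> h' ** (F g - F' g) ** h + (F h - F' h)"
    by (simp add: matrix_diff_ldistrib matrix_diff_rdistrib algebra_simps)
qed

section \<open>Inverses in \<open>SL\<close> and coboundaries\<close>

lemma matrix_inv_eqI:
  fixes h :: "'a::field^'n^'n"
  assumes "h ** h' = mat 1"
  shows "matrix_inv h = h'"
proof -
  have *: "h' ** h = mat 1" using assms by (simp add: matrix_left_right_inverse)
  have "h ** matrix_inv h = mat 1 \<and> matrix_inv h ** h = mat 1"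
    unfolding matrix_inv_def by (rule someI[of _ h']) (simp add: assms *)
  then have "h' ** (h ** matrix_inv h) = h'" by simp
  then show ?thesis by (simp add: matrix_mul_assoc *)
qed

lemma matrix_inv_SL:
  fixes g :: "'a::field^'n^'n"
  assumes "det g = 1"
  shows "g ** matrix_inv g = mat 1" "matrix_inv g ** g = mat 1" "det (matrix_inv g) = 1"
proof -
  obtain h where "det h = 1" "h ** g = mat 1" "g ** h = mat 1" using SL_inverse[OF assms] .
  then show "g ** matrix_inv g = mat 1" "matrix_inv g ** g = mat 1" "det (matrix_inv g) = 1"
    using matrix_inv_eqI[of g h] by auto
qed

lemma matrix_inv_mult:
  fixes g :: "'a::field^'n^'n"
  assumes "det g = 1" "det h = 1"
  shows "matrix_inv (g ** h) = matrix_inv h ** matrix_inv g"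
proof (rule matrix_inv_eqI)
  have "g ** h ** (matrix_inv h ** matrix_inv g) = g ** (h ** matrix_inv h) ** matrix_inv g"
    by (simp only: matrix_mul_assoc)
  then show "g ** h ** (matrix_inv h ** matrix_inv g) = mat 1"
    by (simp add: matrix_inv_SL assms)
qed

lemma matrix_inv_elem_mat: "i \<noteq> j \<Longrightarrow> matrix_inv (elem_mat i j t) = elem_mat i j (- t)"
  by (rule matrix_inv_eqI) (rule elem_mat_inverse)

definition conj_coboundary :: "'a::field^'n^'n \<Rightarrow> 'a^'n^'n \<Rightarrow> 'a^'n^'n" where
  "conj_coboundary v g = v - matrix_inv g ** v ** g"

lemma matrix_cocycle_conj_coboundary:
  fixes v :: "'a::field^'n^'n"
  shows "matrix_cocycle (conj_coboundary v)"
  unfolding matrix_cocycle_def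
proof (intro allI impI)
  fix g h h' :: "'a^'n^'n" assume gh: "det g = 1" "det h = 1" "h ** h' = mat 1"
  have h': "matrix_inv h = h'" by (rule matrix_inv_eqI) fact
  show "conj_coboundary v (g ** h) \<approx> h' ** conj_coboundary v g ** h + conj_coboundary v h"
    by (simp add: conj_coboundary_def matrix_inv_mult gh h' matrix_diff_ldistrib matrix_diff_rdistrib
        matrix_mul_assoc)
qed

lemma conj_coboundary_elem_mat_nth:
  "i \<noteq> j \<Longrightarrow> conj_coboundary v (elem_mat i j t) $ a $ b =
     (if a = i then t * v $ j $ b else 0) - (if b = j then t * v $ a $ i else 0)
       + (if a = i \<and> b = j then t * t * v $ j $ i else 0)"
  by (simp add: conj_coboundary_def matrix_inv_elem_mat elem_mat_conj_nth)

section \<open>Derivations and their logarithmic derivatives\<close>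

definition derivation :: "('a::field \<Rightarrow> 'a) \<Rightarrow> bool" where
  "derivation d \<longleftrightarrow> (\<forall>x y. d (x + y) = d x + d y) \<and> (\<forall>x y. d (x * y) = d x * y + x * d y)"

lemma derivation_add: "derivation d \<Longrightarrow> d (x + y) = d x + d y"
  and derivation_mult: "derivation d \<Longrightarrow> d (x * y) = d x * y + x * d y"
  by (auto simp: derivation_def)

lemma derivation_0: "derivation d \<Longrightarrow> d 0 = 0"
  using derivation_add[of d 0 0] by (simp only: add_0_left add_cancel_right_right)

lemma derivation_1: "derivation d \<Longrightarrow> d 1 = 0"
  using derivation_mult[of d 1 1] by (simp only: mult_1_left mult_1_right add_cancel_right_right)

lemma derivation_sum: "derivation d \<Longrightarrow> d (sum f A) = (\<Sum>a\<in>A. d (f a))"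
  by (induction A rule: infinite_finite_induct) (auto simp: derivation_0 derivation_add)

definition log_deriv :: "('a::field \<Rightarrow> 'a) \<Rightarrow> 'a^'n^'n \<Rightarrow> 'a^'n^'n" where
  "log_deriv d g = matrix_inv g ** (\<chi> a b. d (g $ a $ b))"

lemma derivation_matrix_mult:
  assumes "derivation d"
  shows "(\<chi> a b. d ((g ** h) $ a $ b)) = (\<chi> a b. d (g $ a $ b)) ** h + g ** (\<chi> a b. d (h $ a $ b))"
  using assms
  by (simp add: vec_eq_iff matrix_matrix_mult_def derivation_sum derivation_mult sum.distrib)

text \<open>Multiply \<open>d(gh) = d(g) h + g d(h)\<close> on the left by
  \<open>h^-1 g^-1\<close>.\<close>

lemma log_deriv_mult:
  assumes "derivation d" "det g = 1" "det h = 1"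
  shows "log_deriv d (g ** h) = matrix_inv h ** log_deriv d g ** h + log_deriv d h"
proof -
  have "matrix_inv h ** matrix_inv g ** (g ** X) = matrix_inv h ** (matrix_inv g ** g) ** X" for X
    by (simp only: matrix_mul_assoc)
  then show ?thesis using assms
    by (simp add: log_deriv_def derivation_matrix_mult matrix_inv_mult matrix_inv_SL matrix_add_ldistrib
        matrix_mul_assoc)
qed

lemma matrix_cocycle_log_deriv:
  fixes d :: "'a::field \<Rightarrow> 'a"
  assumes "derivation d"
  shows "matrix_cocycle (log_deriv d :: 'a^'n^'n \<Rightarrow> 'a^'n^'n)"
  unfolding matrix_cocycle_def
proof (intro allI impI)
  fix g h h' :: "'a^'n^'n" assume gh: "det g = 1" "det h = 1" "h ** h' = mat 1"
  then show "log_deriv d (g ** h) \<approx> h' ** log_deriv d g ** h + log_deriv d h"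
    using log_deriv_mult[OF assms gh(1,2)] by (simp add: matrix_inv_eqI[OF gh(3)])
qed

text \<open>Entrywise, \<open>d\<close> sends \<open>e_ij(t)\<close> to \<open>d(t) E_ij\<close>
  because \<open>d 0 = d 1 = 0\<close>, and \<open>e_ij(-t) E_ij = E_ij\<close> for
  \<open>i \<noteq> j\<close>.\<close>

lemma log_deriv_elem_mat:
  "\<lbrakk>derivation d; i \<noteq> j\<rbrakk> \<Longrightarrow> log_deriv d (elem_mat i j t) = unit_mat i j (d t)"
  by (auto simp: log_deriv_def matrix_inv_elem_mat vec_eq_iff elem_mat_mult_nth elem_mat_nth unit_mat_nth
      derivation_0 derivation_1)

section \<open>Consequences of the Steinberg relations\<close>

text \<open>Both expansions of \<open>F\<close> on the common product contain \<open>X + Y\<close>,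
  which cancels and leaves the correction terms of the two conjugations. Off the diagonal a
  congruence is an equality, hence \<open>a \<noteq> b\<close>.\<close>

lemma matrix_cocycle_commute:
  assumes F: "matrix_cocycle F" and ij: "i \<noteq> j" "k \<noteq> l" "i \<noteq> l" "j \<noteq> k" and ab: "a \<noteq> b"
    and X: "X = F (elem_mat i j s)" and Y: "Y = F (elem_mat k l t)"
  shows "(if b = l then t * X $ a $ k else 0) - (if a = k then t * X $ l $ b else 0)
       - (if a = k \<and> b = l then t * t * X $ l $ k else 0)
     = (if b = j then s * Y $ a $ i else 0) - (if a = i then s * Y $ j $ b else 0)
       - (if a = i \<and> b = j then s * s * Y $ j $ i else 0)"
proof -
  have "elem_mat k l (- t) ** X ** elem_mat k l t + Y \<approx> F (elem_mat i j s ** elem_mat k l t)"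
    unfolding X Y
    by (intro scalar_cong_sym[OF matrix_cocycleD[OF F]] det_elem_mat elem_mat_inverse ij)
  also have "elem_mat i j s ** elem_mat k l t = elem_mat k l t ** elem_mat i j s"
    by (intro elem_mat_commute ij)
  also have "F (elem_mat k l t ** elem_mat i j s) \<approx> elem_mat i j (- s) ** Y ** elem_mat i j s + X"
    unfolding X Y
    by (intro matrix_cocycleD[OF F] det_elem_mat elem_mat_inverse ij)
  finally have "(elem_mat k l (- t) ** X ** elem_mat k l t + Y) $ a $ b =
      (elem_mat i j (- s) ** Y ** elem_mat i j s + X) $ a $ b"
    using ab by (simp add: scalar_cong_iff)
  then show ?thesis
    by (simp add: elem_mat_conj_nth algebra_simps split del: if_split)
qed

lemma matrix_cocycle_elem_mat_add:
  assumes "matrix_cocycle F" "i \<noteq> j"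
  shows "F (elem_mat i j (s + t)) \<approx>
    elem_mat i j (- t) ** F (elem_mat i j s) ** elem_mat i j t + F (elem_mat i j t)"
  using matrix_cocycleD[OF assms(1), of "elem_mat i j s" "elem_mat i j t" "elem_mat i j (- t)"] assms(2)
  by (simp add: det_elem_mat elem_mat_add)

lemma matrix_cocycle_commutator:
  assumes F: "matrix_cocycle F" and ij: "i \<noteq> j" "j \<noteq> k" "i \<noteq> k"
  shows "elem_mat j k (- t) ** F (elem_mat i j s) ** elem_mat j k t + F (elem_mat j k t) \<approx>
    elem_mat i k (- (s * t)) ** (elem_mat i j (- s) ** F (elem_mat j k t) ** elem_mat i j s + F (elem_mat i j s))
      ** elem_mat i k (s * t) + F (elem_mat i k (s * t))"
proof -
  have "elem_mat j k (- t) ** F (elem_mat i j s) ** elem_mat j k t + F (elem_mat j k t)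
      \<approx> F (elem_mat i j s ** elem_mat j k t)"
    by (intro scalar_cong_sym[OF matrix_cocycleD[OF F]] det_elem_mat elem_mat_inverse ij)
  also have "elem_mat i j s ** elem_mat j k t = elem_mat j k t ** elem_mat i j s ** elem_mat i k (s * t)"
    by (intro elem_mat_commutator ij)
  also have "F \<dots> \<approx> elem_mat i k (- (s * t)) ** F (elem_mat j k t ** elem_mat i j s)
      ** elem_mat i k (s * t) + F (elem_mat i k (s * t))"
    by (intro matrix_cocycleD[OF F] elem_mat_inverse ij) (simp_all add: det_mul det_elem_mat ij)
  also have "\<dots> \<approx> elem_mat i k (- (s * t)) ** (elem_mat i j (- s) ** F (elem_mat j k t) ** elem_mat i j s
        + F (elem_mat i j s)) ** elem_mat i k (s * t) + F (elem_mat i k (s * t))"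
    by (intro scalar_cong_add scalar_cong_conj matrix_cocycleD[OF F] scalar_cong_refl
        det_elem_mat elem_mat_inverse ij)
  finally show ?thesis .
qed

section \<open>Values on elementary matrices when there are at least four indices\<close>

locale large_matrix_cocycle =
  fixes F :: "'a::field^'n^'n \<Rightarrow> 'a^'n^'n"
  assumes cocycle: "matrix_cocycle F" and card: "CARD('n) > 3"
begin

text \<open>The hypothesis \<open>n > 3\<close> enters the index arguments through this choice of a
  further index.\<close>

lemma obtain_fresh:
  obtains l :: 'n where "l \<noteq> a" "l \<noteq> b" "l \<noteq> c"
proof -
  have "card {a, b, c} \<le> 3" by (simp add: card_insert_if)
  then have "{a, b, c} \<noteq> UNIV" using card by (metis leD)
  then show ?thesis using that by blast
qed

text \<open>In positional instantiation the parameter \<open>t\<close> of the second matrix comes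
  before the parameter \<open>s\<close> of the first.\<close>

lemmas commute = matrix_cocycle_commute[OF cocycle _ _ _ _ _ refl refl]

text \<open>For fresh \<open>l\<close>, \<open>e_il(1)\<close> commutes with \<open>e_ij(s)\<close>,
  and the entry \<open>(a, l)\<close> of the comparison keeps only the wanted term.\<close>

lemma column_source_zero:
  assumes "i \<noteq> j" "a \<noteq> i"
  shows "F (elem_mat i j s) $ a $ i = 0"
proof -
  obtain l where l: "l \<noteq> i" "l \<noteq> j" "l \<noteq> a" using obtain_fresh .
  show ?thesis using commute[of i j i l a l 1 s] assms l by auto
qed

text \<open>The transposed argument, with \<open>e_kj(1)\<close> and the entry
  \<open>(k, b)\<close>.\<close>

lemma row_target_zero:
  assumes "i \<noteq> j" "b \<noteq> j"
  shows "F (elem_mat i j s) $ j $ b = 0"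
proof -
  obtain k where k: "k \<noteq> i" "k \<noteq> j" "k \<noteq> b" using obtain_fresh .
  show ?thesis using commute[of i j k j k b 1 s] assms k by auto
qed

text \<open>Comparison with \<open>e_kl(t)\<close> at the entry \<open>(k, l)\<close>: here the
  quadratic term survives, and one factor \<open>t\<close> cancels.\<close>

lemma disjoint_entry:
  assumes "distinct [i, j, k, l]" "t \<noteq> 0"
  shows "F (elem_mat i j s) $ k $ k - F (elem_mat i j s) $ l $ l = t * F (elem_mat i j s) $ l $ k"
proof -
  let ?X = "F (elem_mat i j s)"
  have "t * ?X $ k $ k - t * ?X $ l $ l - t * t * ?X $ l $ k = 0"
    using commute[of i j k l k l t s] assms by auto
  then have "t * (?X $ k $ k - ?X $ l $ l - t * ?X $ l $ k) = 0" by (simp add: algebra_simps)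
  then show ?thesis using assms by simp
qed

text \<open>If some scalar \<open>t\<close> is neither 0 nor 1, comparing \<open>disjoint_entry\<close> at \<open>t\<close> and at 1 suffices.
  Over the field with two elements commuting relations alone do not force the entry to vanish;
  the relation \<open>e\<^sub>i\<^sub>j(1)\<^sup>2 = 1\<close> and the diagonal of the commutator relation are needed as well.\<close>

lemma disjoint_entry_zero:
  assumes d: "distinct [i, j, k, l]"
  shows "F (elem_mat i j s) $ l $ k = 0"
proof (cases "\<exists>t::'a. t \<noteq> 0 \<and> t \<noteq> 1")
  case True
  then obtain t :: 'a where t: "t \<noteq> 0" "t \<noteq> 1" by blast
  have "t * F (elem_mat i j s) $ l $ k = 1 * F (elem_mat i j s) $ l $ k"
    using disjoint_entry[OF d t(1), of s] disjoint_entry[OF d, of 1 s] by simp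
  then show ?thesis using t by simp
next
  case False
  then have two: "(1::'a) + 1 = 0" by (metis add_cancel_right_right zero_neq_one)
  then have two': "x + x = 0" for x :: 'a by (metis distrib_left mult.right_neutral mult_zero_right)
  have neg: "- x = x" for x :: 'a by (rule minus_unique) (rule two')
  show ?thesis
  proof (cases "s = 0")
    case True
    then show ?thesis using matrix_cocycle_one[OF cocycle] d by (auto simp: scalar_cong_iff)
  next
    case s: False
    then have s1: "s = 1" using False by blast
    \<comment> \<open>\<open>e_ij(1)\<close> is a commutator of \<open>e_ik(1)\<close> and
      \<open>e_kj(1)\<close>. Three relations between entries of \<open>R\<close> follow, and
      together they force \<open>R_lk = 0\<close>.\<close>
    define R where "R = F (elem_mat i j 1)"
    define X where "X = F (elem_mat i k 1)"
    define Y where "Y = F (elem_mat k j 1)"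
    have "R $ k $ k - R $ l $ l = R $ l $ k"
      using disjoint_entry[OF d, of 1 1] by (simp add: R_def)
    moreover have "R $ i $ i = R $ j $ j"
    proof -
      \<comment> \<open>The entry \<open>(i, j)\<close> of the relation
        \<open>e_ij(1)^2 = 1\<close>; the term \<open>2 R_ij\<close> vanishes.\<close>
      have "F (elem_mat i j (1 + 1)) \<approx> elem_mat i j (- 1) ** R ** elem_mat i j 1 + R"
        unfolding R_def by (rule matrix_cocycle_elem_mat_add[OF cocycle]) (use d in simp)
      then have "F (mat 1) \<approx> elem_mat i j (- 1) ** R ** elem_mat i j 1 + R"
        by (simp only: two elem_mat_zero)
      from scalar_cong_trans[OF scalar_cong_sym[OF matrix_cocycle_one[OF cocycle]] this]
      have "0 = (elem_mat i j (- 1) ** R ** elem_mat i j 1 + R) $ i $ j"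
        using d by (simp add: scalar_cong_iff)
      moreover have "R $ j $ i = 0" using column_source_zero[of i j j 1] d by (auto simp: R_def)
      ultimately have "(R $ i $ j + R $ i $ j) + (R $ i $ i - R $ j $ j) = 0"
        using d by (simp only: elem_mat_conj_nth vector_add_component) (simp add: algebra_simps)
      then show ?thesis by (simp only: two' add_0_left right_minus_eq)
    qed
    \<comment> \<open>The diagonal differences \<open>k, l\<close> and \<open>j, i\<close> of the
      commutator congruence give expressions that differ only in a sign.\<close>
    moreover have "R $ k $ k - R $ l $ l = R $ j $ j - R $ i $ i"
    proof -
      let ?L = "elem_mat k j (- 1) ** X ** elem_mat k j 1 + Y"
      let ?M = "elem_mat i j (- (1 * 1)) ** (elem_mat i k (- 1) ** Y ** elem_mat i k 1 + X)
        ** elem_mat i j (1 * 1) + R"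
      have "?L \<approx> ?M"
        unfolding X_def Y_def R_def
        using matrix_cocycle_commutator[OF cocycle, of i k j 1 1] d by auto
      then have eq: "?L $ a $ a - ?M $ a $ a = ?L $ b $ b - ?M $ b $ b" for a b
        unfolding scalar_cong_iff by blast
      have "X $ j $ i = 0" "Y $ j $ i = 0"
        using column_source_zero[of i k j 1] row_target_zero[of k j i 1] d by (auto simp: X_def Y_def)
      then have entries: "?L $ k $ k - ?M $ k $ k = - X $ j $ k - Y $ k $ i - R $ k $ k"
          "?L $ l $ l - ?M $ l $ l = - R $ l $ l"
          "?L $ i $ i - ?M $ i $ i = Y $ k $ i - R $ i $ i"
          "?L $ j $ j - ?M $ j $ j = X $ j $ k - R $ j $ j"
        using d by (auto simp: elem_mat_conj_nth)
      have "R $ k $ k - R $ l $ l = - X $ j $ k - Y $ k $ i"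
        using eq[of k l] unfolding entries by (simp add: algebra_simps)
      moreover have "R $ j $ j - R $ i $ i = X $ j $ k - Y $ k $ i"
        using eq[of j i] unfolding entries by (simp add: algebra_simps)
      ultimately show ?thesis by (simp only: neg)
    qed
    ultimately show ?thesis by (simp add: R_def s1)
  qed
qed

lemma disjoint_diagonal:
  assumes "distinct [i, j, k, l]"
  shows "F (elem_mat i j s) $ k $ k = F (elem_mat i j s) $ l $ l"
  using disjoint_entry[OF assms, of 1 s] disjoint_entry_zero[OF assms, of s] by simp

text \<open>The assumption at parameter 1 is what a suitable coboundary achieves in
  \<open>obtain_elem_mat_values\<close>. It kills the target column at every parameter, which in
  turn kills the source row and equates the diagonal entries.\<close>

lemma elem_mat_value:
  assumes norm: "\<And>i j l. distinct [i, j, l] \<Longrightarrow>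
      F (elem_mat i j 1) $ i $ i = F (elem_mat i j 1) $ l $ l"
    and ij: "i \<noteq> j"
  shows "F (elem_mat i j s) \<approx> unit_mat i j (F (elem_mat i j s) $ i $ j)"
proof -
  \<comment> \<open>Comparison of \<open>e_ij(1)\<close> with \<open>e_il(t)\<close> at the entry
    \<open>(i, l)\<close>; \<open>norm\<close> and \<open>column_source_zero\<close> remove all
    other terms.\<close>
  have target_column: "F (elem_mat i l t) $ j $ l = 0" if d: "distinct [i, j, l]" for i j l t
  proof -
    have "F (elem_mat i j 1) $ l $ i = 0" using column_source_zero[of i j l 1] d by auto
    then show ?thesis
      using commute[of i j i l i l t 1] norm[of i j l] d by auto
  qed
  \<comment> \<open>Comparison with \<open>e_kl(1)\<close> at \<open>(i, l)\<close>; the opposite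
    side is a target column entry of \<open>F\<close> at \<open>e_kl(1)\<close>.\<close>
  have source_row: "F (elem_mat i j t) $ i $ k = 0" if d: "distinct [i, j, k]" for i j k t
  proof -
    obtain l where l: "l \<noteq> i" "l \<noteq> j" "l \<noteq> k" using obtain_fresh .
    show ?thesis
      using commute[of i j k l i l 1 t] target_column[of k j l 1] d l by auto
  qed
  let ?X = "F (elem_mat i j s)"
  have diag_i: "?X $ i $ i = ?X $ l $ l" if l: "l \<noteq> i" "l \<noteq> j" for l
    using commute[of i j i l i l 1 s] target_column[of i j l 1] column_source_zero[of i j l s] l ij
    by auto
  have diag_j: "?X $ j $ j = ?X $ k $ k" if k: "k \<noteq> i" "k \<noteq> j" for k
    using commute[of i j k j k j 1 s] source_row[of k j i 1] row_target_zero[of i j k s] k ij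
    by auto
  obtain l where l: "l \<noteq> i" "l \<noteq> j" using obtain_fresh[of i j j] .
  have diag: "?X $ a $ a = ?X $ l $ l" for a
    using diag_i[of l] diag_j[of l] diag_i[of a] l by metis
  have off: "?X $ a $ b = 0" if ab: "a \<noteq> b" "\<not> (a = i \<and> b = j)" for a b
  proof -
    \<comment> \<open>The possible positions: source column, target row, target column, source row,
      or disjoint from both indices.\<close>
    have "b = i \<or> a = j \<or> b = j \<and> a \<noteq> i \<or> a = i \<and> b \<noteq> j \<and> b \<noteq> i \<or> distinct [i, j, b, a]"
      using ab ij by auto
    then consider "b = i" | "a = j" | "b = j" "a \<noteq> i" | "a = i" "b \<noteq> j" "b \<noteq> i"
      | "distinct [i, j, b, a]"
      by blast
    then show ?thesis
    proof cases
      case 1 then show ?thesis using column_source_zero[of i j a s] ij ab by auto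
    next
      case 2 then show ?thesis using row_target_zero[of i j b s] ij ab by auto
    next
      case 3 then show ?thesis using target_column[of i a j s] ij ab by auto
    next
      case 4 then show ?thesis using source_row[of i j b s] ij ab by auto
    next
      case 5 then show ?thesis by (rule disjoint_entry_zero)
    qed
  qed
  show ?thesis
    unfolding scalar_cong_iff
  proof (intro conjI allI impI)
    show "?X $ a $ b = unit_mat i j (?X $ i $ j) $ a $ b" if "a \<noteq> b" for a b
      using off[of a b] that by (auto simp: unit_mat_nth)
    show "?X $ a $ a - unit_mat i j (?X $ i $ j) $ a $ a = ?X $ b $ b - unit_mat i j (?X $ i $ j) $ b $ b" for a b
      using diag[of a] diag[of b] ij by (auto simp: unit_mat_nth)
  qed
qed

end

section \<open>Elementary matrices generate the special linear group\<close>

text \<open>Gaussian elimination by row operations, phrased as an induction rule: columns are made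
  standard one after another, and each operation is reversed by another elementary matrix.\<close>

lemma SL_induct_elem_mat:
  fixes g :: "'a::field^'n^'n"
  assumes g: "det g = 1"
    and one: "P (mat 1)"
    and step: "\<And>i j t A. \<lbrakk>i \<noteq> j; det A = 1; P A\<rbrakk> \<Longrightarrow> P (elem_mat i j t ** A)"
  shows "P g"
proof -
  define std where "std S A \<longleftrightarrow> (\<forall>j\<in>S. \<forall>a. A $ a $ j = (if a = j then 1 else 0))"
    for S and A :: "'a^'n^'n"
  have undo: "P A" if "i \<noteq> j" "det A = 1" "P (elem_mat i j t ** A)" for i j t A
    using step[of i j "elem_mat i j t ** A" "- t"] that
    by (simp add: matrix_mul_assoc elem_mat_inverse det_mul det_elem_mat)
  \<comment> \<open>Row \<open>k\<close> vanishes in the columns of \<open>S\<close>, so adding a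
    multiple of it preserves them.\<close>
  have std_elem: "std S (elem_mat a k t ** A)" if "std S A" "k \<notin> S" for S A a k t
    using that by (auto simp: std_def elem_mat_mult_nth)
  have clear: "P A"
    if kk: "A $ k $ k \<noteq> 0" and k: "k \<notin> S" and S: "std S A" and A: "det A = 1"
      and B: "\<And>B. \<lbrakk>det B = 1; std S B; B $ k $ k = A $ k $ k; \<forall>a. a \<noteq> k \<longrightarrow> B $ a $ k = 0\<rbrakk> \<Longrightarrow> P B"
    for A k S
  proof -
    \<comment> \<open>\<open>L\<close> collects the rows other than \<open>k\<close> in which column
      \<open>k\<close> may still be nonzero.\<close>
    have "P C" if "finite L" "k \<notin> L" "\<forall>a. a \<noteq> k \<longrightarrow> a \<notin> L \<longrightarrow> C $ a $ k = 0"
      "C $ k $ k = A $ k $ k" "std S C" "det C = 1" for L C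
      using that
    proof (induction L arbitrary: C rule: finite_induct)
      case empty
      then show ?case by (intro B) auto
    next
      case (insert a L)
      let ?C = "elem_mat a k (- (C $ a $ k / C $ k $ k)) ** C"
      have "P ?C"
        by (rule insert.IH)
          (use insert kk k in \<open>auto simp: std_elem det_mul det_elem_mat elem_mat_mult_nth\<close>)
      then show ?case by (rule undo[rotated 2]) (use insert.prems in auto)
    qed
    from this[of "- {k}" A] show ?thesis using A S by simp
  qed
  have "P A" if "det A = 1" "std S A" for S A
    using that
  proof (induction "card (- S)" arbitrary: S A rule: less_induct)
    case less
    note A = less.prems(1) and S = less.prems(2)
    show ?case
    proof (cases "S = UNIV")
      case True
      then have "A = mat 1" using S by (simp add: std_def vec_eq_iff mat_def)
      then show ?thesis by (simp add: one)
    next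
      case False
      then obtain k where k: "k \<notin> S" by blast
      have IH: "P B" if "det B = 1" "std (insert k S) B" for B
      proof (rule less.hyps[OF _ that])
        show "card (- insert k S) < card (- S)" using k by (intro psubset_card_mono) auto
      qed
      have unit_pivot: "P C" if C: "det C = 1" "std S C" "C $ k $ k = 1" for C
        using C(3) by (intro clear[of C k S] C IH k) (auto simp: std_def)
      \<comment> \<open>Adding \<open>(1 - C_kk) / C_ik\<close> times row \<open>i\<close> to row
        \<open>k\<close> makes the pivot equal to 1.\<close>
      have pivot_below: "P C" if C: "det C = 1" "std S C" and i: "i \<notin> S" "i \<noteq> k" "C $ i $ k \<noteq> 0" for C i
      proof -
        have "P (elem_mat k i ((1 - C $ k $ k) / C $ i $ k) ** C)"
          by (rule unit_pivot) (use C i in \<open>auto simp: std_elem det_mul det_elem_mat elem_mat_mult_nth\<close>)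
        then show ?thesis by (rule undo[rotated 2]) (use C i in auto)
      qed
      have "\<exists>i. i \<notin> S \<and> A $ i $ k \<noteq> 0"
      proof (rule ccontr)
        assume "\<not> (\<exists>i. i \<notin> S \<and> A $ i $ k \<noteq> 0)"
        then have 0: "A $ i $ k = 0" if "i \<notin> S" for i using that by blast
        \<comment> \<open>Under the negated claim column \<open>k\<close> is a combination of the
          columns in \<open>S\<close>; \<open>w\<close> is the resulting kernel vector, with entry
          -1 at \<open>k\<close>.\<close>
        define w where "w = (\<chi> j. if j = k then - 1 else if j \<in> S then A $ j $ k else 0)"
        have "(A *v w) $ i = 0" for i
        proof -
          have "(A *v w) $ i = (\<Sum>j\<in>UNIV. (if j = k then - A $ i $ k else 0)
              + (if j = i then if i \<in> S then A $ i $ k else 0 else 0))"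
            by (simp only: matrix_vector_mult_def vec_lambda_beta, rule sum.cong)
              (use S k in \<open>auto simp: w_def std_def\<close>)
          then show ?thesis using 0[of i] by (simp add: sum.distrib)
        qed
        then have "A *v w = 0" by (simp add: vec_eq_iff)
        then have "matrix_inv A *v (A *v w) = 0" by simp
        then have "w = 0" by (simp add: matrix_vector_mul_assoc matrix_inv_SL A)
        then have "w $ k = 0" by simp
        then show False by (simp add: w_def)
      qed
      then obtain i where i: "i \<notin> S" "A $ i $ k \<noteq> 0" by blast
      show ?thesis
      proof (cases "\<exists>m. m \<notin> S \<and> m \<noteq> k")
        case True
        then obtain m where m: "m \<notin> S" "m \<noteq> k" by blast
        show ?thesis
        proof (cases "i = k")
          case ik: True
          show ?thesis
          proof (cases "A $ m $ k = 0")
            case True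
            \<comment> \<open>Row \<open>m\<close> has a zero in column \<open>k\<close>, so the
              nonzero pivot is first copied there.\<close>
            have "P (elem_mat m k 1 ** A)"
              by (rule pivot_below[of _ m])
                (use A S m i ik k True in \<open>auto simp: std_elem det_mul det_elem_mat elem_mat_mult_nth\<close>)
            then show ?thesis by (rule undo[rotated 2]) (use A m in auto)
          next
            case False
            then show ?thesis using pivot_below A S m by blast
          qed
        next
          case False
          then show ?thesis using pivot_below A S i by blast
        qed
      next
        case False
        \<comment> \<open>Only column \<open>k\<close> is left, so no other row can adjust the
          pivot. Once the column is cleared the matrix is diagonal, and \<open>det B = 1\<close>
          makes the pivot 1.\<close>
        then have Suniv: "insert k S = UNIV" by blast
        have "i = k" using i Suniv by blast
        then have "A $ k $ k \<noteq> 0" using i by simp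
        then show ?thesis
        proof (rule clear[OF _ k S A])
          fix B assume B: "det B = 1" "std S B" "\<forall>a. a \<noteq> k \<longrightarrow> B $ a $ k = 0"
          have offd: "B $ a $ b = 0" if "a \<noteq> b" for a b
            using B(2,3) that Suniv by (cases "b = k") (auto simp: std_def)
          have diag: "B $ a $ a = 1" if "a \<noteq> k" for a
            using B(2) that Suniv by (auto simp: std_def)
          have "det B = (\<Prod>a\<in>UNIV. B $ a $ a)" by (rule det_diagonal) (rule offd)
          also have "\<dots> = (\<Prod>a\<in>UNIV. if a = k then B $ k $ k else 1)"
            using diag by (intro prod.cong) auto
          finally have "B $ k $ k = 1" using B(1) by simp
          with diag have "B $ a $ a = 1" for a by (cases "a = k") auto
          then show "P B" using offd by (intro IH B) (auto simp: std_def)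
        qed
      qed
    qed
  qed
  from this[of g "{}"] g show ?thesis by (simp add: std_def)
qed

text \<open>Applied to a difference of cocycles, this shows that the values on elementary matrices
  determine a cocycle modulo scalars.\<close>

lemma matrix_cocycle_zero_on_SL:
  fixes F :: "'a::field^'n^'n \<Rightarrow> 'a^'n^'n"
  assumes F: "matrix_cocycle F" and el: "\<And>i j t. i \<noteq> j \<Longrightarrow> F (elem_mat i j t) \<approx> 0" and g: "det g = 1"
  shows "F g \<approx> 0"
  using g
proof (induction g rule: SL_induct_elem_mat[consumes 1, case_names one step])
  case one
  show ?case by (rule matrix_cocycle_one[OF F])
next
  case (step i j t A)
  then have "F (elem_mat i j t ** A) \<approx> matrix_inv A ** F (elem_mat i j t) ** A + F A"
    by (intro matrix_cocycleD[OF F]) (simp_all add: det_elem_mat matrix_inv_SL)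
  also have "\<dots> \<approx> matrix_inv A ** 0 ** A + 0"
    using step by (intro scalar_cong_add scalar_cong_conj el) (simp_all add: matrix_inv_SL)
  finally show ?case by simp
qed

section \<open>Classification of matrix cocycles\<close>

lemma conj_coboundary_add: "conj_coboundary (v + w) g = conj_coboundary v g + conj_coboundary w g"
  by (simp add: conj_coboundary_def matrix_add_ldistrib matrix_add_rdistrib)

context large_matrix_cocycle
begin

lemma diff_conj_coboundary: "large_matrix_cocycle (\<lambda>g. F g - conj_coboundary v g)"
  by unfold_locales (intro matrix_cocycle_diff cocycle matrix_cocycle_conj_coboundary card)+

lemma obtain_elem_mat_values:
  obtains v where "\<And>i j t. i \<noteq> j \<Longrightarrow> \<exists>c. F (elem_mat i j t) - conj_coboundary v (elem_mat i j t) \<approx> unit_mat i j c"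
proof -
  define fresh where "fresh i j = (SOME l::'n. l \<noteq> i \<and> l \<noteq> j)" for i j
  have fresh: "fresh i j \<noteq> i \<and> fresh i j \<noteq> j" for i j
    unfolding fresh_def by (rule someI_ex) (metis obtain_fresh)
  \<comment> \<open>The coboundary of \<open>v\<close> at \<open>e_ij(1)\<close> has entry
    \<open>v_ji\<close> at \<open>(i, i)\<close> and 0 at \<open>(l, l)\<close> for other
    \<open>l \<noteq> j\<close>, so \<open>v_ji\<close> is the diagonal difference to be
    removed.\<close>
  define v where "v = (\<chi> j i. if i = j then 0 else F (elem_mat i j 1) $ i $ i
    - F (elem_mat i j 1) $ fresh i j $ fresh i j)"
  interpret N: large_matrix_cocycle "\<lambda>g. F g - conj_coboundary v g" by (rule diff_conj_coboundary)
  have norm: "(F (elem_mat i j 1) - conj_coboundary v (elem_mat i j 1)) $ i $ i =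
      (F (elem_mat i j 1) - conj_coboundary v (elem_mat i j 1)) $ l $ l" if d: "distinct [i, j, l]" for i j l
  proof -
    have "F (elem_mat i j 1) $ l $ l = F (elem_mat i j 1) $ fresh i j $ fresh i j"
    proof (cases "l = fresh i j")
      case False
      then show ?thesis using disjoint_diagonal[of i j l "fresh i j" 1] fresh[of i j] d by auto
    qed simp
    then show ?thesis using d by (auto simp: conj_coboundary_elem_mat_nth v_def)
  qed
  show ?thesis
    by (rule that[of v]) (use N.elem_mat_value[OF norm] in blast)
qed

lemma elem_mat_value_entries:
  assumes "F (elem_mat i j t) \<approx> unit_mat i j c" "i \<noteq> j"
  shows "F (elem_mat i j t) $ i $ j = c"
    and "\<lbrakk>a \<noteq> b; a \<noteq> i \<or> b \<noteq> j\<rbrakk> \<Longrightarrow> F (elem_mat i j t) $ a $ b = 0"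
    and "F (elem_mat i j t) $ a $ a = F (elem_mat i j t) $ b $ b"
proof -
  show "F (elem_mat i j t) $ i $ j = c"
    "\<lbrakk>a \<noteq> b; a \<noteq> i \<or> b \<noteq> j\<rbrakk> \<Longrightarrow> F (elem_mat i j t) $ a $ b = 0"
    using assms unfolding scalar_cong_iff by (auto simp: unit_mat_nth)
  have "F (elem_mat i j t) $ a $ a - unit_mat i j c $ a $ a = F (elem_mat i j t) $ b $ b - unit_mat i j c $ b $ b"
    using assms(1) unfolding scalar_cong_iff by blast
  then show "F (elem_mat i j t) $ a $ a = F (elem_mat i j t) $ b $ b"
    using assms(2) by (auto simp: unit_mat_nth split: if_splits)
qed

lemma obtain_derivation:
  assumes el: "\<And>i j t. i \<noteq> j \<Longrightarrow> \<exists>c. F (elem_mat i j t) \<approx> unit_mat i j c"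
  obtains v d where "derivation d"
    "\<And>g. det g = 1 \<Longrightarrow> F g \<approx> conj_coboundary v g + log_deriv d g"
proof -
  define x where "x i j t = F (elem_mat i j t) $ i $ j" for i j t
  have entry: "F (elem_mat i j t) $ a $ b = 0" if "i \<noteq> j" "a \<noteq> b" "a \<noteq> i \<or> b \<noteq> j" for i j t a b
    using el[OF that(1), of t] elem_mat_value_entries(2)[of i j t _ a b] that by blast
  have diag: "F (elem_mat i j t) $ a $ a = F (elem_mat i j t) $ b $ b" if "i \<noteq> j" for i j t a b
    using el[OF that(1), of t] elem_mat_value_entries(3)[of i j t _ a b] that by blast
  have val: "F (elem_mat i j t) \<approx> unit_mat i j (x i j t)" if "i \<noteq> j" for i j t
    using el[OF that(1), of t] elem_mat_value_entries(1)[of i j t] that by (auto simp: x_def)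
  have x_add: "x i j (s + t) = x i j s + x i j t" if ij: "i \<noteq> j" for i j s t
  proof -
    have "x i j (s + t) = (elem_mat i j (- t) ** F (elem_mat i j s) ** elem_mat i j t
        + F (elem_mat i j t)) $ i $ j"
      using matrix_cocycle_elem_mat_add[OF cocycle ij, of s t] ij by (simp add: x_def scalar_cong_iff)
    then show ?thesis
      using ij entry[OF ij, of j i s] diag[OF ij, of s i j]
      by (simp add: elem_mat_conj_nth x_def)
  qed
  \<comment> \<open>The entry \<open>(i, k)\<close> of the commutator congruence; the vanishing
    entries and equal diagonals strip the conjugations.\<close>
  have x_mult: "x i k (s * t) = x i j s * t + s * x j k t" if d: "distinct [i, j, k]" for i j k s t
  proof -
    define X Y R where "X = F (elem_mat i j s)" and "Y = F (elem_mat j k t)" and "R = F (elem_mat i k (s * t))"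
    have ij: "i \<noteq> j" "j \<noteq> k" "i \<noteq> k" using d by auto
    have "(elem_mat j k (- t) ** X ** elem_mat j k t + Y) $ i $ k =
      (elem_mat i k (- (s * t)) ** (elem_mat i j (- s) ** Y ** elem_mat i j s + X) ** elem_mat i k (s * t) + R) $ i $ k"
      using matrix_cocycle_commutator[OF cocycle ij, of t s] ij
      unfolding X_def Y_def R_def scalar_cong_iff by blast
    moreover have "X $ i $ k = 0" "X $ k $ i = 0" "X $ i $ i = X $ k $ k"
      using entry[of i j i k s] entry[of i j k i s] diag[of i j s i k] ij by (auto simp: X_def)
    moreover have "Y $ i $ k = 0" "Y $ k $ i = 0" "Y $ j $ i = 0" "Y $ i $ i = Y $ k $ k"
      using entry[of j k i k t] entry[of j k k i t] entry[of j k j i t] diag[of j k t i k] ij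
      by (auto simp: Y_def)
    moreover have "x i j s = X $ i $ j" "x j k t = Y $ j $ k" "x i k (s * t) = R $ i $ k"
      by (simp_all add: x_def X_def Y_def R_def)
    ultimately show ?thesis
      using ij by (simp add: elem_mat_conj_nth) (simp add: algebra_simps)
  qed
  have x_one: "x i k 1 = x i j 1 + x j k 1" if "distinct [i, j, k]" for i j k
    using x_mult[OF that, of 1 1] by simp
  obtain p :: 'n where True by blast
  obtain q where q: "q \<noteq> p" using obtain_fresh[of p p p] .
  \<comment> \<open>The values at 1 are additive along chains of indices, so they are differences of
    a potential \<open>u\<close>, normalised by \<open>u p = 0\<close>.\<close>
  define u where "u i = (if i = p then 0 else - x i p 1)" for i
  have x_one_u: "x i j 1 = u j - u i" if ij: "i \<noteq> j" for i j
  proof -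
    consider "j = p" | "i = p" | "i \<noteq> p" "j \<noteq> p" by blast
    then show ?thesis
    proof cases
      case 1 then show ?thesis using ij by (simp add: u_def)
    next
      case 2
      obtain k where k: "k \<noteq> p" "k \<noteq> j" using obtain_fresh[of p j j] .
      \<comment> \<open>\<open>x_one\<close> needs distinct indices, so antisymmetry is obtained
        through a third index \<open>k\<close>.\<close>
      have "x j p 1 + x p j 1 = 0"
        using x_one[of k p j] x_one[of k j p] k ij 2 by auto
      then have "x p j 1 = - x j p 1" by (simp add: eq_neg_iff_add_eq_0 add.commute)
      then show ?thesis using ij 2 by (auto simp: u_def)
    next
      case 3
      then show ?thesis using x_one[of i j p] ij by (auto simp: u_def)
    qed
  qed
  \<comment> \<open>The coboundary of this diagonal matrix sends \<open>e_ij(t)\<close> to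
    \<open>t (u_j - u_i) E_ij\<close>; \<open>y\<close> is what remains of \<open>x\<close>.\<close>
  define v where "v = (\<chi> i j. if i = j then u i else 0)"
  define y where "y i j t = x i j t - t * (u j - u i)" for i j t
  have y_add: "y i j (s + t) = y i j s + y i j t" if "i \<noteq> j" for i j s t
    using that by (simp add: y_def x_add algebra_simps)
  have y_mult: "y i k (s * t) = y i j s * t + s * y j k t" if "distinct [i, j, k]" for i j k s t
    using x_mult[OF that, of s t] by (simp add: y_def algebra_simps)
  have y_one: "y i j 1 = 0" if "i \<noteq> j" for i j
    using that by (simp add: y_def x_one_u)
  \<comment> \<open>With one argument equal to 1, the product rule shows that \<open>y\<close>
    depends on neither source nor target.\<close>
  have y_source: "y i k t = y j k t" if "i \<noteq> k" "j \<noteq> k" for i j k t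
    using y_mult[of i j k 1 t] y_one[of i j] that by (cases "i = j") auto
  have y_target: "y i k t = y i j t" if "i \<noteq> k" "i \<noteq> j" for i j k t
    using y_mult[of i j k t 1] y_one[of j k] that by (cases "j = k") auto
  define d where "d = y p q"
  have y_eq: "y i j t = d t" if ij: "i \<noteq> j" for i j t
  proof (cases "i = q")
    case False
    then show ?thesis
      using y_target[of i j q t] y_source[of i q p t] ij q by (simp add: d_def)
  next
    case True
    \<comment> \<open>From source \<open>q\<close> the target cannot be moved to \<open>q\<close>,
      hence the detour through \<open>m\<close>.\<close>
    obtain m where m: "m \<noteq> p" "m \<noteq> q" using obtain_fresh[of p q q] .
    then show ?thesis
      using y_target[of i j m t] y_source[of i m p t] y_target[of p m q t] ij q True by (simp add: d_def)
  qed
  obtain r where r: "r \<noteq> p" "r \<noteq> q" using obtain_fresh[of p q q] .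
  have d: "derivation d"
    unfolding derivation_def
  proof (intro conjI allI)
    show "d (s + t) = d s + d t" for s t using y_add[of p q s t] q by (simp add: d_def)
    show "d (s * t) = d s * t + s * d t" for s t
      using y_mult[of p r q s t] y_eq[of p r s] y_eq[of r q t] q r by (auto simp: d_def)
  qed
  have "F g - conj_coboundary v g - log_deriv d g \<approx> 0" if g: "det g = 1" for g
  proof (rule matrix_cocycle_zero_on_SL[OF _ _ g])
    show "matrix_cocycle (\<lambda>g. F g - conj_coboundary v g - log_deriv d g)"
      by (intro matrix_cocycle_diff cocycle matrix_cocycle_conj_coboundary matrix_cocycle_log_deriv d)
    fix i j :: 'n and t assume ij: "i \<noteq> j"
    have "conj_coboundary v (elem_mat i j t) = unit_mat i j (t * (u j - u i))"
      using ij by (auto simp: vec_eq_iff conj_coboundary_elem_mat_nth v_def unit_mat_nth algebra_simps)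
    moreover have "log_deriv d (elem_mat i j t) = unit_mat i j (d t)"
      using d ij by (rule log_deriv_elem_mat)
    moreover have "unit_mat i j (x i j t) - unit_mat i j (t * (u j - u i)) - unit_mat i j (d t) = 0"
      using y_eq[OF ij, of t] by (auto simp: vec_eq_iff unit_mat_nth y_def)
    ultimately show "F (elem_mat i j t) - conj_coboundary v (elem_mat i j t) - log_deriv d (elem_mat i j t) \<approx> 0"
      using scalar_cong_diff[OF scalar_cong_diff[OF val[OF ij, of t] scalar_cong_refl] scalar_cong_refl]
      by metis
  qed
  then have "F g \<approx> conj_coboundary v g + log_deriv d g" if "det g = 1" for g
    using scalar_cong_add[OF _ scalar_cong_refl[of "conj_coboundary v g + log_deriv d g"]] that
    by fastforce
  with d show ?thesis using that by blast
qed

end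

theorem matrix_cocycle_classification:
  fixes F :: "'a::field^'n^'n \<Rightarrow> 'a^'n^'n"
  assumes "matrix_cocycle F" "CARD('n) > 3"
  obtains v d where "derivation d"
    "\<And>g. det g = 1 \<Longrightarrow> F g \<approx> conj_coboundary v g + log_deriv d g"
proof -
  interpret large_matrix_cocycle F by unfold_locales fact+
  obtain w where w: "\<And>i j t. i \<noteq> j \<Longrightarrow>
      \<exists>c. F (elem_mat i j t) - conj_coboundary w (elem_mat i j t) \<approx> unit_mat i j c"
    using obtain_elem_mat_values by blast
  interpret N: large_matrix_cocycle "\<lambda>g. F g - conj_coboundary w g" by (rule diff_conj_coboundary)
  obtain v d where d: "derivation d"
    and v: "\<And>g. det g = 1 \<Longrightarrow> F g - conj_coboundary w g \<approx> conj_coboundary v g + log_deriv d g"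
    using N.obtain_derivation[OF w] by blast
  have "F g \<approx> conj_coboundary (v + w) g + log_deriv d g" if "det g = 1" for g
    using scalar_cong_add[OF v[OF that] scalar_cong_refl[of "conj_coboundary w g"]]
    by (simp add: conj_coboundary_add algebra_simps)
  with d show ?thesis using that by blast
qed

section \<open>The trace form and the coadjoint module\<close>

text \<open>The isomorphism is built from derivations to cohomology, where an explicit formula
  exists, and is reversed at the end.\<close>

lemma linearly_isomorphic_sym:
  assumes V: "module K V" and W: "module K W" and iso: "linearly_isomorphic K V W"
  shows "linearly_isomorphic K W V"
proof -
  interpret V: module K V by (rule V)
  interpret W: module K W by (rule W)
  obtain h where h: "h \<in> iso (add_monoid V) (add_monoid W)"
    and lin: "\<And>c v. \<lbrakk>c \<in> carrier K; v \<in> carrier V\<rbrakk> \<Longrightarrow> h (c \<odot>\<^bsub>V\<^esub> v) = c \<odot>\<^bsub>W\<^esub> h v"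
    using iso by (auto simp: linearly_isomorphic_def linear_iso_def)
  let ?k = "inv_into (carrier V) h"
  have bij: "bij_betw h (carrier V) (carrier W)" using h by (simp add: iso_def)
  have "?k \<in> iso (add_monoid W) (add_monoid V)"
    using group.iso_set_sym[OF V.a_group h] by simp
  moreover have "?k (c \<odot>\<^bsub>W\<^esub> w) = c \<odot>\<^bsub>V\<^esub> ?k w" if c: "c \<in> carrier K" and w: "w \<in> carrier W" for c w
  proof -
    have k: "?k w \<in> carrier V" "h (?k w) = w"
      using bij w by (auto simp: bij_betw_def inv_into_into f_inv_into_f)
    then have "h (c \<odot>\<^bsub>V\<^esub> ?k w) = c \<odot>\<^bsub>W\<^esub> w" using lin c by simp
    then show ?thesis
      using inv_into_f_f[of h "carrier V" "c \<odot>\<^bsub>V\<^esub> ?k w"] bij k c by (simp add: bij_betw_def)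
  qed
  ultimately show ?thesis
    unfolding linearly_isomorphic_def linear_iso_def by blast
qed

text \<open>Restriction makes the functional extensional, as in \<open>dual_module\<close>. Letting
  \<open>X\<close> range over all matrices keeps the description of the dual valid when the
  characteristic divides \<open>n\<close>.\<close>

definition trace_form :: "'a::field^'n^'n \<Rightarrow> 'a^'n^'n \<Rightarrow> 'a" where
  "trace_form X = (\<lambda>a\<in>{a. trace a = 0}. trace (X ** a))"

lemma trace_mult_unit_mat: "trace (X ** unit_mat i j t) = X $ j $ i * t"
  by (simp add: trace_def mult_unit_mat_nth)

lemma trace_unit_mat: "trace (unit_mat i j t) = (if i = j then t else 0)"
  by (cases "i = j") (auto simp: trace_def unit_mat_nth intro!: sum.neutral)

lemma trace_mat_mult: "trace (mat c ** X) = c * trace X" for X :: "'a::field^'n^'n"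
  by (simp add: trace_def mat_mult_nth sum_distrib_left)

lemma trace_form_apply: "trace a = 0 \<Longrightarrow> trace_form X a = trace (X ** a)"
  by (simp add: trace_form_def)

text \<open>Scalar matrices pair to zero with traceless ones; conversely the test matrices
  \<open>E_ba\<close> and \<open>E_aa - E_bb\<close> recover the data in
  \<open>scalar_cong_iff\<close>.\<close>

lemma trace_form_eq_iff: "trace_form X = trace_form Y \<longleftrightarrow> X \<approx> Y"
proof
  assume "X \<approx> Y"
  then obtain c where X: "X = Y + mat c" by (auto simp: scalar_cong_def)
  show "trace_form X = trace_form Y"
    unfolding trace_form_def X
    by (rule restrict_ext) (simp add: matrix_add_rdistrib trace_add trace_mat_mult)
next
  assume eq: "trace_form X = trace_form Y"
  have tr: "trace (X ** a) = trace (Y ** a)" if "trace a = 0" for a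
    using fun_cong[OF eq, of a] that by (simp add: trace_form_apply)
  show "X \<approx> Y"
    unfolding scalar_cong_iff
  proof (intro conjI allI impI)
    show "X $ a $ b = Y $ a $ b" if "a \<noteq> b" for a b
      using tr[of "unit_mat b a 1"] that by (simp add: trace_unit_mat trace_mult_unit_mat)
    show "X $ a $ a - Y $ a $ a = X $ b $ b - Y $ b $ b" for a b
      using tr[of "unit_mat a a 1 - unit_mat b b 1"]
      by (simp add: trace_sub trace_unit_mat trace_mult_unit_mat matrix_diff_ldistrib)
         (simp add: algebra_simps)
  qed
qed

text \<open>Scaling is rewritten as a product with \<open>mat c\<close>, so that matrix algebra
  applies to it.\<close>

lemma carrier_coadjoint_module:
  "carrier (coadjoint_module :: ('a::field, 'a^'n^'n \<Rightarrow> 'a) module) = {\<alpha> \<in> {x. trace x = 0} \<rightarrow>\<^sub>E UNIV.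
     (\<forall>v w. trace v = 0 \<longrightarrow> trace w = 0 \<longrightarrow> \<alpha> (v + w) = \<alpha> v + \<alpha> w) \<and>
     (\<forall>c v. trace v = 0 \<longrightarrow> \<alpha> (mat c ** v) = c * \<alpha> v)}"
proof -
  have "(\<chi> i j. c * v $ i $ j) = mat c ** v" for c and v :: "'a^'n^'n"
    by (simp add: vec_eq_iff mat_mult_nth)
  then show ?thesis
    by (simp add: coadjoint_module_def dual_module_def adjoint_module_def)
qed

lemma trace_form_in_carrier:
  fixes X :: "'a::field^'n^'n"
  shows "trace_form X \<in> carrier coadjoint_module"
proof -
  have "X ** (mat c ** v) = mat c ** (X ** v)" for c and v :: "'a^'n^'n"
    by (metis (no_types) matrix_mul_assoc mat_mult_nth mult_mat_nth mult.commute vec_eq_iff)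
  then show ?thesis
    by (auto simp: carrier_coadjoint_module trace_form_def trace_add matrix_add_ldistrib trace_mat_mult)
qed

lemma coadjoint_module_trace_form:
  assumes \<alpha>: "\<alpha> \<in> carrier (coadjoint_module :: ('a::field, 'a^'n^'n \<Rightarrow> 'a) module)"
  obtains X where "\<alpha> = trace_form X"
proof -
  have add: "\<alpha> (v + w) = \<alpha> v + \<alpha> w" if "trace v = 0" "trace w = 0" for v w
    using \<alpha> that by (simp add: carrier_coadjoint_module)
  have scale: "\<alpha> (mat c ** v) = c * \<alpha> v" if "trace v = 0" for c v
    using \<alpha> that by (simp add: carrier_coadjoint_module)
  have zero: "\<alpha> 0 = 0" using scale[of 0 0] by (simp add: trace_def)
  have trace_sum: "trace (sum f A) = (\<Sum>x\<in>A. trace (f x))" for f :: "'b \<Rightarrow> 'a^'n^'n" and A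
    by (induction A rule: infinite_finite_induct) (simp_all add: trace_add, simp_all add: trace_def)
  have sum: "\<alpha> (sum f A) = (\<Sum>x\<in>A. \<alpha> (f x))" if "\<And>x. trace (f x) = 0" for f :: "'b \<Rightarrow> 'a^'n^'n" and A
    by (induction A rule: infinite_finite_induct) (simp_all add: zero add that trace_sum)
  fix o' :: 'n
  \<comment> \<open>Traceless matrix units: diagonal ones are corrected at the fixed position
    \<open>o'\<close>. In the sum of all \<open>a_ij B_ij\<close> the corrections add up to
    \<open>trace a = 0\<close>.\<close>
  define B :: "'n \<Rightarrow> 'n \<Rightarrow> 'a^'n^'n"
    where "B i j = unit_mat i j 1 - unit_mat o' o' (if i = j then 1 else 0)" for i j
  have B: "trace (B i j) = 0" for i j by (simp add: B_def trace_sub trace_unit_mat)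
  have scaled: "trace (mat c ** B i j) = 0" for c i j by (simp add: trace_mat_mult B)
  define X where "X = (\<chi> j i. \<alpha> (B i j))"
  have "\<alpha> = trace_form X"
  proof
    fix a
    show "\<alpha> a = trace_form X a"
    proof (cases "trace a = 0")
      case True
      have "a $ p $ q = (\<Sum>i\<in>UNIV. \<Sum>j\<in>UNIV. mat (a $ i $ j) ** B i j) $ p $ q" for p q
      proof -
        have "(\<Sum>i\<in>UNIV. \<Sum>j\<in>UNIV. mat (a $ i $ j) ** B i j) $ p $ q =
          (\<Sum>i\<in>UNIV. \<Sum>j\<in>UNIV. (if j = q then if i = p then a $ p $ q else 0 else 0)
             - (if j = i then if p = o' \<and> q = o' then a $ i $ i else 0 else 0))"
          by (auto simp: mat_mult_nth B_def unit_mat_nth intro!: sum.cong)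
        also have "\<dots> = a $ p $ q - (if p = o' \<and> q = o' then trace a else 0)"
          by (auto simp: sum_subtractf trace_def)
        finally show ?thesis using True by simp
      qed
      then have "a = (\<Sum>i\<in>UNIV. \<Sum>j\<in>UNIV. mat (a $ i $ j) ** B i j)"
        unfolding vec_eq_iff by blast
      then have "\<alpha> a = \<alpha> (\<Sum>i\<in>UNIV. \<Sum>j\<in>UNIV. mat (a $ i $ j) ** B i j)"
        by (rule arg_cong)
      also have "\<dots> = (\<Sum>i\<in>UNIV. \<Sum>j\<in>UNIV. a $ i $ j * \<alpha> (B i j))"
        by (simp add: sum trace_sum scaled scale B)
      also have "\<dots> = (\<Sum>j\<in>UNIV. \<Sum>i\<in>UNIV. X $ j $ i * a $ i $ j)"
        by (subst sum.swap) (simp add: X_def mult.commute)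
      also have "\<dots> = trace_form X a"
        using True by (simp add: trace_form_apply) (simp add: trace_def matrix_matrix_mult_def)
      finally show ?thesis .
    next
      case False
      then show ?thesis using \<alpha> by (auto simp: trace_form_def carrier_coadjoint_module PiE_def extensional_def)
    qed
  qed
  then show ?thesis by (rule that)
qed

lemma trace_form_add: "trace_form X \<oplus>\<^bsub>coadjoint_module\<^esub> trace_form Y = trace_form (X + Y)"
  by (auto simp: coadjoint_module_def dual_module_def adjoint_module_def fun_module_def scalars_def
      trace_form_def matrix_add_rdistrib trace_add)

lemma trace_form_smult: "c \<odot>\<^bsub>coadjoint_module\<^esub> trace_form X = trace_form (mat c ** X)"
  by (auto simp: coadjoint_module_def dual_module_def adjoint_module_def fun_module_def scalars_def
      trace_form_def trace_mat_mult matrix_mul_assoc[symmetric])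

lemma trace_form_diff:
  "trace_form X \<ominus>\<^bsub>coadjoint_module\<^esub> trace_form Y = trace_form (X - Y)"
proof -
  interpret group_module SL scalars "coadjoint_module :: ('a, 'a^'n^'n \<Rightarrow> 'a) module" coadjoint_action
    by (rule group_module_coadjoint)
  have "trace_form X = trace_form (X - Y) \<oplus>\<^bsub>coadjoint_module\<^esub> trace_form Y"
    by (simp add: trace_form_add)
  then show ?thesis
    by (simp add: V.minus_eq V.a_assoc V.r_neg trace_form_in_carrier)
qed

lemma carrier_SL: "carrier SL = {g. det g = 1}"
  by (simp add: SL_def)

lemma inv_SL:
  assumes "det g = 1"
  shows "inv\<^bsub>SL\<^esub> g = matrix_inv g"
proof -
  interpret G: group SL by (rule group_SL)
  show ?thesis by (rule G.inv_equality) (simp_all add: SL_def matrix_inv_SL assms)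
qed

text \<open>Cyclicity of the trace moves \<open>g^-1\<close> to the front.\<close>

lemma coadjoint_action_trace_form:
  assumes "det g = 1"
  shows "coadjoint_action (trace_form X) g = trace_form (matrix_inv g ** X ** g)"
proof
  fix a
  show "coadjoint_action (trace_form X) g a = trace_form (matrix_inv g ** X ** g) a"
  proof (cases "trace a = 0")
    case True
    have "trace (X ** (g ** a ** matrix_inv g)) = trace ((X ** g ** a) ** matrix_inv g)"
      by (simp add: matrix_mul_assoc)
    also have "\<dots> = trace (matrix_inv g ** (X ** g ** a))" by (rule trace_mul_sym)
    finally have "trace (X ** (g ** a ** matrix_inv g)) = trace (matrix_inv g ** X ** g ** a)"
      by (simp add: matrix_mul_assoc)
    then show ?thesis
      using assms True trace_conj[OF matrix_inv_SL(2)[OF assms], of a]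
      by (simp add: coadjoint_action_apply carrier_SL inv_SL trace_form_apply)
  next
    case False
    then show ?thesis
      by (simp add: coadjoint_action_def dual_action_def adjoint_module_def trace_form_def)
  qed
qed

section \<open>Cohomology of the coadjoint module\<close>

definition trace_cocycle :: "('a::field^'n^'n \<Rightarrow> 'a^'n^'n) \<Rightarrow> 'a^'n^'n \<Rightarrow> 'a^'n^'n \<Rightarrow> 'a" where
  "trace_cocycle F = (\<lambda>g\<in>carrier SL. trace_form (F g))"

abbreviation coadjoint_Z1 :: "('a::field, 'a^'n^'n \<Rightarrow> 'a^'n^'n \<Rightarrow> 'a) module" where
  "coadjoint_Z1 \<equiv> Z1 SL coadjoint_module coadjoint_action"

abbreviation coadjoint_B1 :: "('a::field^'n^'n \<Rightarrow> 'a^'n^'n \<Rightarrow> 'a) set" where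
  "coadjoint_B1 \<equiv> B1 SL coadjoint_module coadjoint_action"

lemma trace_cocycle_eq_iff:
  "trace_cocycle F = trace_cocycle F' \<longleftrightarrow> (\<forall>g. det g = 1 \<longrightarrow> F g \<approx> F' g)"
  by (auto simp: trace_cocycle_def fun_eq_iff restrict_def carrier_SL trace_form_eq_iff[symmetric] split: if_splits)

lemma trace_cocycle_in_Z1:
  assumes "matrix_cocycle F"
  shows "trace_cocycle F \<in> carrier coadjoint_Z1"
proof -
  have "trace_form (F (g ** h)) =
      coadjoint_action (trace_form (F g)) h \<oplus>\<^bsub>coadjoint_module\<^esub> trace_form (F h)"
    if "det g = 1" "det h = 1" for g h
    using matrix_cocycleD[OF assms that matrix_inv_SL(1)[OF that(2)]] that
    by (simp add: coadjoint_action_trace_form trace_form_add trace_form_eq_iff)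
  then show ?thesis
    by (auto simp: Z1_def trace_cocycle_def SL_def trace_form_in_carrier det_mul)
qed

text \<open>A matrix is chosen for each value of \<open>f\<close>. The lift obeys the cocycle rule
  only modulo scalars, which is why \<open>matrix_cocycle\<close> uses
  \<open>\<approx>\<close>.\<close>

lemma Z1_trace_cocycle:
  fixes f :: "'a::field^'n^'n \<Rightarrow> 'a^'n^'n \<Rightarrow> 'a"
  assumes "f \<in> carrier coadjoint_Z1"
  obtains F where "matrix_cocycle F" "f = trace_cocycle F"
proof -
  have f: "f \<in> carrier SL \<rightarrow>\<^sub>E carrier coadjoint_module"
    and mult: "\<And>g h. \<lbrakk>det g = 1; det h = 1\<rbrakk> \<Longrightarrow>
      f (g ** h) = coadjoint_action (f g) h \<oplus>\<^bsub>coadjoint_module\<^esub> f h"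
    using assms by (auto simp: Z1_def SL_def)
  have "\<exists>X. f g = trace_form X" if "det g = 1" for g
  proof -
    have "f g \<in> carrier coadjoint_module" using f that by (auto simp: carrier_SL)
    then show ?thesis by (rule coadjoint_module_trace_form) blast
  qed
  then obtain F where F: "\<And>g. det g = 1 \<Longrightarrow> f g = trace_form (F g)" by metis
  have "matrix_cocycle F"
    unfolding matrix_cocycle_def
  proof (intro allI impI)
    fix g h h' :: "'a^'n^'n" assume gh: "det g = 1" "det h = 1" "h ** h' = mat 1"
    have "trace_form (F (g ** h)) = trace_form (matrix_inv h ** F g ** h + F h)"
      using mult[OF gh(1,2)] gh by (simp add: F det_mul coadjoint_action_trace_form trace_form_add)
    then show "F (g ** h) \<approx> h' ** F g ** h + F h"
      by (simp add: trace_form_eq_iff matrix_inv_eqI[OF gh(3)])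
  qed
  moreover have "f = trace_cocycle F"
    using f F by (auto simp: trace_cocycle_def fun_eq_iff restrict_def carrier_SL PiE_def extensional_def)
  ultimately show ?thesis by (rule that)
qed

lemma trace_cocycle_add:
  "trace_cocycle F \<oplus>\<^bsub>coadjoint_Z1\<^esub> trace_cocycle F' = trace_cocycle (\<lambda>g. F g + F' g)"
  by (auto simp: Z1_def fun_module_def trace_cocycle_def trace_form_add intro!: restrict_ext)

lemma trace_cocycle_smult:
  "c \<odot>\<^bsub>coadjoint_Z1\<^esub> trace_cocycle F = trace_cocycle (\<lambda>g. mat c ** F g)"
  by (auto simp: Z1_def fun_module_def trace_cocycle_def trace_form_smult intro!: restrict_ext)

lemma coadjoint_B1_eq:
  "coadjoint_B1 = range (\<lambda>v :: 'a::field^'n^'n. trace_cocycle (conj_coboundary v))"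
proof -
  have carrier: "carrier coadjoint_module = range (trace_form :: 'a^'n^'n \<Rightarrow> _)"
    using trace_form_in_carrier by (auto elim!: coadjoint_module_trace_form)
  have "(\<lambda>g\<in>carrier SL. trace_form v \<ominus>\<^bsub>coadjoint_module\<^esub> coadjoint_action (trace_form v) g)
      = trace_cocycle (conj_coboundary v)" for v :: "'a^'n^'n"
    by (auto simp: trace_cocycle_def conj_coboundary_def carrier_SL coadjoint_action_trace_form
        trace_form_diff intro!: restrict_ext)
  then show ?thesis by (simp add: B1_def carrier image_image)
qed

lemma carrier_Der: "carrier Der = {d. derivation d}"
  by (simp add: Der_def derivation_def)

lemma log_deriv_add:
  "log_deriv (\<lambda>x. d x + d' x) = (\<lambda>g :: 'a::field^'n^'n. log_deriv d g + log_deriv d' g)"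
proof
  fix g :: "'a^'n^'n"
  have "(\<chi> a b. d (g $ a $ b) + d' (g $ a $ b)) = (\<chi> a b. d (g $ a $ b)) + (\<chi> a b. d' (g $ a $ b))"
    by (simp add: vec_eq_iff)
  then show "log_deriv (\<lambda>x. d x + d' x) g = log_deriv d g + log_deriv d' g"
    by (simp add: log_deriv_def matrix_add_ldistrib)
qed

lemma log_deriv_smult:
  "log_deriv (\<lambda>x. c * d x) = (\<lambda>g :: 'a::field^'n^'n. mat c ** log_deriv d g)"
proof
  fix g :: "'a^'n^'n"
  have "(\<chi> a b. c * d (g $ a $ b)) = (\<chi> a b. d (g $ a $ b)) ** mat c"
    by (simp add: vec_eq_iff mult_mat_nth mult.commute)
  then have "log_deriv (\<lambda>x. c * d x) g = log_deriv d g ** mat c"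
    by (simp add: log_deriv_def matrix_mul_assoc)
  then show "log_deriv (\<lambda>x. c * d x) g = mat c ** log_deriv d g"
    by (simp add: vec_eq_iff mult_mat_nth mat_mult_nth mult.commute)
qed

text \<open>At \<open>e_ij(t)\<close> the coboundary contributes a linear and a quadratic term in
  \<open>t\<close>. The diagonal at \<open>t = 1\<close> kills the quadratic coefficient, and then
  \<open>d 1 = d' 1 = 0\<close> kills the linear one.\<close>

lemma log_deriv_coboundary_imp_eq:
  fixes v :: "'a::field^'n^'n"
  assumes d: "derivation d" "derivation d'" and card: "CARD('n) > 3"
    and eq: "\<And>g::'a^'n^'n. det g = 1 \<Longrightarrow> log_deriv d g \<approx> conj_coboundary v g + log_deriv d' g"
  shows "d = d'"
proof
  fix t
  interpret large_matrix_cocycle "conj_coboundary v"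
    by unfold_locales (rule matrix_cocycle_conj_coboundary card)+
  obtain i j :: 'n where ij: "i \<noteq> j" by (metis obtain_fresh)
  obtain l where l: "l \<noteq> i" "l \<noteq> j" using obtain_fresh[of i j j] .
  have el: "unit_mat i j (d t) \<approx> conj_coboundary v (elem_mat i j t) + unit_mat i j (d' t)" for t
    using eq[OF det_elem_mat[OF ij, of t]] by (simp add: log_deriv_elem_mat d ij)
  have entry: "d t - d' t = t * (v $ j $ j - v $ i $ i) + t * t * v $ j $ i" for t
  proof -
    have "unit_mat i j (d t) $ i $ j = (conj_coboundary v (elem_mat i j t) + unit_mat i j (d' t)) $ i $ j"
      using el[of t] ij unfolding scalar_cong_iff by blast
    then show ?thesis
      using ij by (simp add: unit_mat_nth conj_coboundary_elem_mat_nth algebra_simps)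
  qed
  have "unit_mat i j (d 1) $ i $ i - (conj_coboundary v (elem_mat i j 1) + unit_mat i j (d' 1)) $ i $ i =
      unit_mat i j (d 1) $ l $ l - (conj_coboundary v (elem_mat i j 1) + unit_mat i j (d' 1)) $ l $ l"
    using el[of 1] unfolding scalar_cong_iff by blast
  then have "v $ j $ i = 0"
    using ij l by (simp add: unit_mat_nth conj_coboundary_elem_mat_nth)
  moreover have "v $ j $ j - v $ i $ i = 0"
    using entry[of 1] calculation by (simp add: derivation_1 d)
  ultimately show "d t = d' t" using entry[of t] by simp
qed

theorem theorem1p4:
  assumes "CARD('n::finite) > 3"
  shows "linearly_isomorphic (scalars :: ('a::field, 'a) module)
    (H1 (SL :: ('a^'n^'n) monoid) coadjoint_module coadjoint_action)
    (Der :: ('a, 'a \<Rightarrow> 'a) module)"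
proof -
  interpret group_module "SL :: ('a^'n^'n) monoid" scalars coadjoint_module coadjoint_action
    by (rule group_module_coadjoint)
  let ?Z = "coadjoint_Z1 :: ('a, 'a^'n^'n \<Rightarrow> 'a^'n^'n \<Rightarrow> 'a) module"
  let ?B = "coadjoint_B1 :: ('a^'n^'n \<Rightarrow> 'a^'n^'n \<Rightarrow> 'a) set"
  let ?H = "H1 (SL :: ('a^'n^'n) monoid) coadjoint_module coadjoint_action"
  interpret Z: module scalars ?Z by (rule module_Z1)
  interpret B: submodule ?B scalars ?Z by (rule B1_submodule)
  interpret B: abelian_subgroup ?B ?Z
    by (intro abelian_subgroupI3 additive_subgroupI B.subgroup_axioms Z.abelian_group_axioms)
  define \<Phi> where "\<Phi> d = ?B +>\<^bsub>?Z\<^esub> trace_cocycle (log_deriv d)" for d :: "'a \<Rightarrow> 'a"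
  have Z: "trace_cocycle (log_deriv d) \<in> carrier ?Z" if "derivation d" for d :: "'a \<Rightarrow> 'a"
    using that by (intro trace_cocycle_in_Z1 matrix_cocycle_log_deriv)
  have inj: "d = d'" if d: "derivation d" "derivation d'" and eq: "\<Phi> d = \<Phi> d'" for d d'
  proof -
    have "trace_cocycle (log_deriv d) \<in> \<Phi> d'"
      using B.a_rcos_self[OF Z[OF d(1)]] eq by (simp add: \<Phi>_def)
    then obtain v where "trace_cocycle (log_deriv d) =
        trace_cocycle (conj_coboundary v) \<oplus>\<^bsub>?Z\<^esub> trace_cocycle (log_deriv d')"
      by (auto simp: \<Phi>_def a_r_coset_def' coadjoint_B1_eq)
    then show ?thesis
      using log_deriv_coboundary_imp_eq[OF d assms, of v]
      by (simp add: trace_cocycle_add trace_cocycle_eq_iff)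
  qed
  have surj: "A \<in> \<Phi> ` {d. derivation d}" if "A \<in> carrier ?H" for A
  proof -
    have "A \<in> a_rcosets\<^bsub>?Z\<^esub> ?B"
      using that by (simp add: H1_def quotient_module_def)
    then obtain f where f: "f \<in> carrier ?Z" and A: "A = ?B +>\<^bsub>?Z\<^esub> f"
      unfolding A_RCOSETS_def' by blast
    obtain F where F: "matrix_cocycle F" "f = trace_cocycle F" using Z1_trace_cocycle[OF f] .
    obtain v d where d: "derivation d"
      and v: "\<And>g. det g = 1 \<Longrightarrow> F g \<approx> conj_coboundary v g + log_deriv d g"
      using matrix_cocycle_classification[OF F(1) assms] by blast
    \<comment> \<open>The classification places \<open>f\<close> itself in the coset of
      \<open>log_deriv d\<close>; cosets with a common element coincide.\<close>
    have "f = trace_cocycle (conj_coboundary v) \<oplus>\<^bsub>?Z\<^esub> trace_cocycle (log_deriv d)"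
      using v by (simp add: F trace_cocycle_add trace_cocycle_eq_iff)
    then have "f \<in> \<Phi> d"
      by (auto simp: \<Phi>_def a_r_coset_def' coadjoint_B1_eq)
    then have "A = \<Phi> d"
      using Z.a_repr_independence[OF _ _ B.a_subgroup] Z[OF d] by (simp add: A \<Phi>_def)
    then show ?thesis using d by blast
  qed
  have closed: "\<Phi> d \<in> carrier ?H" if "derivation d" for d
    using Z[OF that] by (auto simp: \<Phi>_def H1_def quotient_module_def A_RCOSETS_def')
  have "\<Phi> \<in> linear_iso scalars Der ?H"
    unfolding linear_iso_def iso_def hom_def bij_betw_def
  proof (intro CollectI conjI ballI; simp?)
    show "\<Phi> \<in> carrier Der \<rightarrow> carrier ?H" using closed by (simp add: carrier_Der)
    show "\<Phi> (d \<oplus>\<^bsub>Der\<^esub> d') = \<Phi> d \<oplus>\<^bsub>?H\<^esub> \<Phi> d'" if "d \<in> carrier Der" "d' \<in> carrier Der" for d d'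
    proof -
      have "d \<oplus>\<^bsub>Der\<^esub> d' = (\<lambda>x. d x + d' x)" by (simp add: Der_def fun_module_def scalars_def restrict_def)
      then show ?thesis
        using B.a_rcos_sum[OF Z Z, of d d'] that
        by (simp add: \<Phi>_def carrier_Der H1_def quotient_module_def trace_cocycle_add log_deriv_add)
    qed
    show "inj_on \<Phi> (carrier Der)" by (rule inj_onI) (auto simp: carrier_Der intro: inj)
    show "\<Phi> ` carrier Der = carrier ?H" using closed surj by (auto simp: carrier_Der)
    show "\<Phi> (c \<odot>\<^bsub>Der\<^esub> d) = c \<odot>\<^bsub>?H\<^esub> \<Phi> d" if "c \<in> carrier scalars" "d \<in> carrier Der" for c d
    proof -
      have "c \<odot>\<^bsub>Der\<^esub> d = (\<lambda>x. c * d x)" by (simp add: Der_def fun_module_def scalars_def restrict_def)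
      then show ?thesis
        using quotient_smult_coset[OF module_Z1 B1_submodule that(1) Z, of d] that
        by (simp add: \<Phi>_def carrier_Der H1_def trace_cocycle_smult log_deriv_smult)
    qed
  qed
  then have "linearly_isomorphic scalars Der ?H"
    by (auto simp: linearly_isomorphic_def)
  then show ?thesis
    by (rule linearly_isomorphic_sym[OF module_Der module_H1])
qed

end
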